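(* Let $\Gamma$ be a compact metric graph, $\kappa,\tau>0$, $\alpha>\frac12$, and let $u$ be the solution of $L^{\alpha/2}(\tau u)=\mathcal{W}$ on $\Gamma$, where $L=\kappa^2-\Delta_\Gamma$ with $\Delta_\Gamma$ the Kirchhoff Laplacian and $\mathcal{W}$ is Gaussian white noise on $L_2(\Gamma)$. Then $$u(s)=\tau^{-1}\sum_{i=1}^\infty\xi_i(\kappa^2+\hat\lambda_i)^{-\alpha/2}\varphi_i(s),$$ where $\xi_i$ are independent standard Gaussian variables. Further, the partial sums $u_n(s)=\tau^{-1}\sum_{i=1}^n\xi_i(\kappa^2+\hat\lambda_i)^{-\alpha/2}\varphi_i(s)$ converge in $L_2(\Omega)$ uniformly in $s$, that is, $$\lim_{n\to\infty}\sup_{s\in\Gamma}\mathbb{E}\left(|u(s)-u_n(s)|^2\right)=0.$$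
   Context: Graph. A compact metric graph $\Gamma$ is a connected graph with a finite set $\mathcal{V}$ of vertices and a finite set $\mathcal{E}$ of edges (loops and multiple edges allowed); each edge $e$ joins a pair of vertices, has a length $\ell_e\in(0,\infty)$, and is identified with the interval $[0,\ell_e]$, its endpoints being identified with its vertices. $\mathcal{E}_v$ denotes the edges incident to $v\in\mathcal{V}$. $L_2(\Gamma)=\bigoplus_{e}L_2(e)$ (Lebesgue measure on each edge); $C(\Gamma)$ is the space of continuous functions on $\Gamma$; $\widetilde H^k(\Gamma)=\bigoplus_e H^k(e)$. Operator. The Kirchhoff Laplacian $\Delta_\Gamma$ acts as $f_e\mapsto f_e''$ on each edge, with domain $\{f\in\widetilde H^2(\Gamma)\cap C(\Gamma): \sum_{e\in\mathcal{E}_v}\partial_e f(v)=0\ \forall v\in\mathcal{V}\}$, where $\partial_e$ is the derivative along $e$ in the direction away from $v$ (a loop at $v$ contributes one term for each of its two ends). $\{\varphi_i\}_{i\in\mathbb{N}}$ is an $L_2(\Gamma)$-orthonormal basis of (continuous) eigenfunctions of $-\Delta_\Gamma$ with eigenvalues $0\le\hat\lambda_1\le\hat\lambda_2\le\cdots$; thus $L\varphi_i=\lambda_i\varphi_i$ with $\lambda_i=\kappa^2+\hat\lambda_i$, and $L^{\beta}\phi=\sum_i\lambda_i^{\beta}(\phi,\varphi_i)_{L_2(\Gamma)}\varphi_i$. Field. $\mathcal{W}$ is Gaussian white noise on $L_2(\Gamma)$ over a complete probability space $(\Omega,\mathcal{F},\mathbb{P})$: a centered Gaussian family $\{\mathcal{W}(h):h\in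 L_2(\Gamma)\}$ with $\mathbb{E}[\mathcal{W}(h)\mathcal{W}(g)]=(h,g)_{L_2(\Gamma)}$. For $\alpha>\frac12$, the equation $L^{\alpha/2}(\tau u)=\mathcal{W}$ has a unique solution, the centered Gaussian $L_2(\Gamma)$-valued random variable with $(u,\psi)_{L_2(\Gamma)}=\mathcal{W}(\tau^{-1}L^{-\alpha/2}\psi)$ a.s. for all $\psi\in L_2(\Gamma)$. It has a modification with continuous sample paths, and $u(s)$ refers to this modification. *)

theory Defs
  imports "Graph_Theory.Digraph_Component" "HOL-Probability.Probability"
begin

section \<open>Compact metric graphs\<close>

text \<open>
  The underlying combinatorial graph is a digraph \<open>G\<close> (loops and parallel arcs allowed). The
  direction of an arc \<open>e\<close> only records how \<open>e\<close> is parametrised by \<open>[0, l e]\<close>: \<open>0\<close> corresponds to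
  \<open>tail G e\<close> and \<open>l e\<close> to \<open>head G e\<close>. Connectedness refers to the underlying undirected graph.
\<close>

definition compact_metric_graph :: "('v, 'e) pre_digraph \<Rightarrow> ('e \<Rightarrow> real) \<Rightarrow> bool" where
  "compact_metric_graph G l \<longleftrightarrow>
     fin_digraph G \<and> Digraph_Component.connected G \<and> (\<forall>e\<in>arcs G. 0 < l e)"

datatype ('v, 'e) graph_point = Vertex 'v | Interior 'e real

definition graph_points :: "('v, 'e) pre_digraph \<Rightarrow> ('e \<Rightarrow> real) \<Rightarrow> ('v, 'e) graph_point set" where
  "graph_points G l =
     Vertex ` verts G \<union> {Interior e t | e t. e \<in> arcs G \<and> 0 < t \<and> t < l e}"

text \<open>The canonical map from the interval \<open>[0, l e]\<close> into the graph, gluing endpoints to vertices.\<close>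

definition edge_point ::
    "('v, 'e) pre_digraph \<Rightarrow> ('e \<Rightarrow> real) \<Rightarrow> 'e \<Rightarrow> real \<Rightarrow> ('v, 'e) graph_point" where
  "edge_point G l e t =
     (if t \<le> 0 then Vertex (tail G e) else if l e \<le> t then Vertex (head G e) else Interior e t)"

text \<open>The quotient topology for the gluing of the intervals \<open>[0, l e]\<close> at the vertices.\<close>

definition graph_topology ::
    "('v, 'e) pre_digraph \<Rightarrow> ('e \<Rightarrow> real) \<Rightarrow> ('v, 'e) graph_point topology" where
  "graph_topology G l = topology (\<lambda>U. U \<subseteq> graph_points G l \<and>
     (\<forall>e\<in>arcs G. openin (top_of_set {0..l e}) {t \<in> {0..l e}. edge_point G l e t \<in> U}))"

lemma edge_point_in_graph_points:
  assumes "compact_metric_graph G l" "e \<in> arcs G"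
  shows "edge_point G l e t \<in> graph_points G l"
proof -
  interpret fin_digraph G using assms by (simp add: compact_metric_graph_def)
  show ?thesis using assms(2) by (auto simp: edge_point_def graph_points_def)
qed

lemma openin_graph_topology:
  "openin (graph_topology G l) U \<longleftrightarrow> U \<subseteq> graph_points G l \<and>
     (\<forall>e\<in>arcs G. openin (top_of_set {0..l e}) {t \<in> {0..l e}. edge_point G l e t \<in> U})"
proof -
  have "istopology (\<lambda>U. U \<subseteq> graph_points G l \<and>
     (\<forall>e\<in>arcs G. openin (top_of_set {0..l e}) {t \<in> {0..l e}. edge_point G l e t \<in> U}))"
    unfolding istopology_def
  proof (intro conjI allI impI ballI; (elim conjE)?)
    fix S T e
    assume S: "\<forall>e\<in>arcs G. openin (top_of_set {0..l e}) {t \<in> {0..l e}. edge_point G l e t \<in> S}"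
      and T: "\<forall>e\<in>arcs G. openin (top_of_set {0..l e}) {t \<in> {0..l e}. edge_point G l e t \<in> T}"
      and e: "e \<in> arcs G"
    have "{t \<in> {0..l e}. edge_point G l e t \<in> S \<inter> T} =
        {t \<in> {0..l e}. edge_point G l e t \<in> S} \<inter> {t \<in> {0..l e}. edge_point G l e t \<in> T}"
      by auto
    then show "openin (top_of_set {0..l e}) {t \<in> {0..l e}. edge_point G l e t \<in> S \<inter> T}"
      using S[rule_format, OF e] T[rule_format, OF e] by (simp only: openin_Int)
  next
    fix K e
    assume K: "\<forall>U\<in>K. U \<subseteq> graph_points G l \<and>
        (\<forall>e\<in>arcs G. openin (top_of_set {0..l e}) {t \<in> {0..l e}. edge_point G l e t \<in> U})"
      and e: "e \<in> arcs G"
    have "{t \<in> {0..l e}. edge_point G l e t \<in> \<Union>K} =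
        \<Union>((\<lambda>U. {t \<in> {0..l e}. edge_point G l e t \<in> U}) ` K)"
      by auto
    moreover have "openin (top_of_set {0..l e})
        (\<Union>((\<lambda>U. {t \<in> {0..l e}. edge_point G l e t \<in> U}) ` K))"
      by (rule openin_Union) (use K e in blast)
    ultimately show "openin (top_of_set {0..l e}) {t \<in> {0..l e}. edge_point G l e t \<in> \<Union>K}"
      by simp
  qed (auto)
  then show ?thesis by (simp add: graph_topology_def topology_inverse')
qed

lemma topspace_graph_topology:
  assumes "compact_metric_graph G l"
  shows "topspace (graph_topology G l) = graph_points G l"
proof
  show "topspace (graph_topology G l) \<subseteq> graph_points G l"
    using openin_graph_topology[of G l "topspace (graph_topology G l)"] by simp
  have "{t \<in> {0..l e}. edge_point G l e t \<in> graph_points G l} = {0..l e}" if "e \<in> arcs G" for e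
    using edge_point_in_graph_points[OF assms that] by auto
  then have "openin (graph_topology G l) (graph_points G l)"
    unfolding openin_graph_topology by simp
  then show "graph_points G l \<subseteq> topspace (graph_topology G l)"
    by (rule openin_subset)
qed

lemma continuous_map_graph_topology:
  fixes f :: "('v, 'e) graph_point \<Rightarrow> real"
  assumes "compact_metric_graph G l"
  shows "continuous_map (graph_topology G l) euclideanreal f \<longleftrightarrow>
    (\<forall>e\<in>arcs G. continuous_on {0..l e} (\<lambda>t. f (edge_point G l e t)))"
proof -
  have eq: "{t \<in> {0..l e}. edge_point G l e t \<in> {x \<in> graph_points G l. f x \<in> U}} =
      {0..l e} \<inter> (\<lambda>t. f (edge_point G l e t)) -` U" if "e \<in> arcs G" for e U
    using edge_point_in_graph_points[OF assms that] by auto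
  have iff: "openin (graph_topology G l) {x \<in> graph_points G l. f x \<in> U} \<longleftrightarrow> (\<forall>e\<in>arcs G.
      openin (top_of_set {0..l e}) ({0..l e} \<inter> (\<lambda>t. f (edge_point G l e t)) -` U))" for U
    unfolding openin_graph_topology by (subst ball_cong[OF refl arg_cong[OF eq]]) auto
  have "continuous_map (graph_topology G l) euclideanreal f \<longleftrightarrow>
      (\<forall>U. open U \<longrightarrow> openin (graph_topology G l) {x \<in> graph_points G l. f x \<in> U})"
    by (simp add: continuous_map_def topspace_graph_topology[OF assms])
  also have "\<dots> \<longleftrightarrow> (\<forall>e\<in>arcs G. \<forall>U. open U \<longrightarrow>
      openin (top_of_set {0..l e}) ({0..l e} \<inter> (\<lambda>t. f (edge_point G l e t)) -` U))"
    unfolding iff by blast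
  also have "\<dots> \<longleftrightarrow> (\<forall>e\<in>arcs G. continuous_on {0..l e} (\<lambda>t. f (edge_point G l e t)))"
    by (simp only: continuous_openin_preimage_eq)
  finally show ?thesis .
qed


section \<open>Function spaces on a metric graph\<close>

text \<open>
  A function on the graph is a function on its points; its edge components are the compositions
  with \<^const>\<open>edge_point\<close>. Elements of \<open>L\<^sub>2\<close> are represented by functions, without passing to
  classes modulo null sets.
\<close>

definition edge_fun ::
    "('v, 'e) pre_digraph \<Rightarrow> ('e \<Rightarrow> real) \<Rightarrow> (('v, 'e) graph_point \<Rightarrow> real) \<Rightarrow> 'e \<Rightarrow> real \<Rightarrow> real" where
  "edge_fun G l f e = (\<lambda>t. f (edge_point G l e t))"

definition interval_L2 :: "real \<Rightarrow> (real \<Rightarrow> real) set" where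
  "interval_L2 a = {f. f \<in> borel_measurable (lebesgue_on {0..a}) \<and>
     integrable (lebesgue_on {0..a}) (\<lambda>t. (f t)\<^sup>2)}"

definition graph_L2 ::
    "('v, 'e) pre_digraph \<Rightarrow> ('e \<Rightarrow> real) \<Rightarrow> (('v, 'e) graph_point \<Rightarrow> real) set" where
  "graph_L2 G l = {f. \<forall>e\<in>arcs G. edge_fun G l f e \<in> interval_L2 (l e)}"

definition graph_inner :: "('v, 'e) pre_digraph \<Rightarrow> ('e \<Rightarrow> real) \<Rightarrow>
    (('v, 'e) graph_point \<Rightarrow> real) \<Rightarrow> (('v, 'e) graph_point \<Rightarrow> real) \<Rightarrow> real" where
  "graph_inner G l f g =
     (\<Sum>e\<in>arcs G. LINT t|lebesgue_on {0..l e}. edge_fun G l f e t * edge_fun G l g e t)"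

definition graph_norm ::
    "('v, 'e) pre_digraph \<Rightarrow> ('e \<Rightarrow> real) \<Rightarrow> (('v, 'e) graph_point \<Rightarrow> real) \<Rightarrow> real" where
  "graph_norm G l f = sqrt (graph_inner G l f f)"

definition test_fun :: "real \<Rightarrow> (real \<Rightarrow> real) \<Rightarrow> bool" where
  "test_fun a \<eta> \<longleftrightarrow> (\<forall>n x. (deriv ^^ n) \<eta> field_differentiable (at x)) \<and>
     (\<exists>c d. 0 < c \<and> d < a \<and> (\<forall>x. x \<notin> {c..d} \<longrightarrow> \<eta> x = 0))"

text \<open>\<open>g\<close> is a \<open>k\<close>-th weak derivative of \<open>f\<close> on the open interval \<open>(0, a)\<close>.\<close>

definition weak_deriv :: "real \<Rightarrow> nat \<Rightarrow> (real \<Rightarrow> real) \<Rightarrow> (real \<Rightarrow> real) \<Rightarrow> bool" where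
  "weak_deriv a k f g \<longleftrightarrow> (\<forall>\<eta>. test_fun a \<eta> \<longrightarrow>
     (LINT t|lebesgue_on {0..a}. f t * (deriv ^^ k) \<eta> t) =
     (-1) ^ k * (LINT t|lebesgue_on {0..a}. g t * \<eta> t))"

definition interval_sobolev :: "nat \<Rightarrow> real \<Rightarrow> (real \<Rightarrow> real) set" where
  "interval_sobolev k a =
     {f \<in> interval_L2 a. \<forall>j\<le>k. \<exists>g\<in>interval_L2 a. weak_deriv a j f g}"

definition graph_sobolev ::
    "nat \<Rightarrow> ('v, 'e) pre_digraph \<Rightarrow> ('e \<Rightarrow> real) \<Rightarrow> (('v, 'e) graph_point \<Rightarrow> real) set" where
  "graph_sobolev k G l = {f. \<forall>e\<in>arcs G. edge_fun G l f e \<in> interval_sobolev k (l e)}"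


section \<open>The Kirchhoff Laplacian\<close>

text \<open>
  Sum over the edge ends at \<open>v\<close> of the derivatives directed away from \<open>v\<close>; a loop contributes to
  both sums. The one-sided derivatives exist for every continuous function that is \<open>H\<^sup>2\<close> on each
  edge, since such a function is continuously differentiable on each closed edge.
\<close>

definition outward_derivative_sum :: "('v, 'e) pre_digraph \<Rightarrow> ('e \<Rightarrow> real) \<Rightarrow>
    (('v, 'e) graph_point \<Rightarrow> real) \<Rightarrow> 'v \<Rightarrow> real" where
  "outward_derivative_sum G l f v =
     (\<Sum>e\<in>{e \<in> arcs G. tail G e = v}. vector_derivative (edge_fun G l f e) (at 0 within {0..l e})) +
     (\<Sum>e\<in>{e \<in> arcs G. head G e = v}. - vector_derivative (edge_fun G l f e) (at (l e) within {0..l e}))"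

definition kirchhoff_domain ::
    "('v, 'e) pre_digraph \<Rightarrow> ('e \<Rightarrow> real) \<Rightarrow> (('v, 'e) graph_point \<Rightarrow> real) set" where
  "kirchhoff_domain G l = {f \<in> graph_sobolev 2 G l.
     continuous_map (graph_topology G l) euclideanreal f \<and>
     (\<forall>v\<in>verts G. outward_derivative_sum G l f v = 0)}"

text \<open>\<open>kirchhoff_laplacian G l f g\<close>: \<open>f\<close> is in the domain, and \<open>g\<close> represents its image.\<close>

definition kirchhoff_laplacian :: "('v, 'e) pre_digraph \<Rightarrow> ('e \<Rightarrow> real) \<Rightarrow>
    (('v, 'e) graph_point \<Rightarrow> real) \<Rightarrow> (('v, 'e) graph_point \<Rightarrow> real) \<Rightarrow> bool" where
  "kirchhoff_laplacian G l f g \<longleftrightarrow> f \<in> kirchhoff_domain G l \<and> g \<in> graph_L2 G l \<and>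
     (\<forall>e\<in>arcs G. weak_deriv (l e) 2 (edge_fun G l f e) (edge_fun G l g e))"

definition orthonormal_basis :: "('v, 'e) pre_digraph \<Rightarrow> ('e \<Rightarrow> real) \<Rightarrow>
    (nat \<Rightarrow> ('v, 'e) graph_point \<Rightarrow> real) \<Rightarrow> bool" where
  "orthonormal_basis G l \<phi> \<longleftrightarrow>
     (\<forall>i. \<phi> i \<in> graph_L2 G l) \<and>
     (\<forall>i j. graph_inner G l (\<phi> i) (\<phi> j) = (if i = j then 1 else 0)) \<and>
     (\<forall>f\<in>graph_L2 G l. \<forall>\<epsilon>>0. \<exists>n c. graph_norm G l (\<lambda>x. f x - (\<Sum>i<n. c i * \<phi> i x)) < \<epsilon>)"

text \<open>Indices start at \<open>0\<close>: \<open>\<phi> i\<close> and \<open>\<mu> i\<close> are the \<open>(i + 1)\<close>-st eigenfunction and eigenvalue.\<close>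

definition kirchhoff_eigenbasis :: "('v, 'e) pre_digraph \<Rightarrow> ('e \<Rightarrow> real) \<Rightarrow>
    (nat \<Rightarrow> real) \<Rightarrow> (nat \<Rightarrow> ('v, 'e) graph_point \<Rightarrow> real) \<Rightarrow> bool" where
  "kirchhoff_eigenbasis G l \<mu> \<phi> \<longleftrightarrow>
     orthonormal_basis G l \<phi> \<and>
     (\<forall>i. kirchhoff_laplacian G l (\<phi> i) (\<lambda>x. - \<mu> i * \<phi> i x)) \<and>
     (\<forall>i. 0 \<le> \<mu> i) \<and> incseq \<mu>"

text \<open>
  \<open>g\<close> represents \<open>L\<^sup>\<beta> \<psi> = (\<Sum>i. \<lambda>\<^sub>i\<^sup>\<beta> (\<psi>, \<phi> i) \<phi> i)\<close> for \<open>L = \<kappa>\<^sup>2 - \<Delta>\<close>, \<open>\<lambda>\<^sub>i = \<kappa>\<^sup>2 + \<mu> i\<close>, the series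
  being taken in \<open>L\<^sub>2\<close> of the graph.
\<close>

definition fractional_power :: "('v, 'e) pre_digraph \<Rightarrow> ('e \<Rightarrow> real) \<Rightarrow> real \<Rightarrow>
    (nat \<Rightarrow> real) \<Rightarrow> (nat \<Rightarrow> ('v, 'e) graph_point \<Rightarrow> real) \<Rightarrow> real \<Rightarrow>
    (('v, 'e) graph_point \<Rightarrow> real) \<Rightarrow> (('v, 'e) graph_point \<Rightarrow> real) \<Rightarrow> bool" where
  "fractional_power G l \<kappa> \<mu> \<phi> \<beta> \<psi> g \<longleftrightarrow> g \<in> graph_L2 G l \<and>
     (\<lambda>n. graph_norm G l (\<lambda>x. g x -
        (\<Sum>i<n. (\<kappa>\<^sup>2 + \<mu> i) powr \<beta> * graph_inner G l \<psi> (\<phi> i) * \<phi> i x))) \<longlonglongrightarrow> 0"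


section \<open>White noise and the stochastic equation\<close>

text \<open>The second case is the degenerate Gaussian law of variance \<open>0\<close>.\<close>

definition centered_gaussian :: "'w measure \<Rightarrow> ('w \<Rightarrow> real) \<Rightarrow> bool" where
  "centered_gaussian M X \<longleftrightarrow>
     (\<exists>\<sigma>>0. distributed M lborel X (normal_density 0 \<sigma>)) \<or>
     (X \<in> borel_measurable M \<and> (AE \<omega> in M. X \<omega> = 0))"

definition white_noise :: "('v, 'e) pre_digraph \<Rightarrow> ('e \<Rightarrow> real) \<Rightarrow> 'w measure \<Rightarrow>
    ((('v, 'e) graph_point \<Rightarrow> real) \<Rightarrow> 'w \<Rightarrow> real) \<Rightarrow> bool" where
  "white_noise G l M W \<longleftrightarrow>
     (\<forall>H c. finite H \<and> H \<subseteq> graph_L2 G l \<longrightarrow> centered_gaussian M (\<lambda>\<omega>. \<Sum>h\<in>H. c h * W h \<omega>)) \<and>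
     (\<forall>h\<in>graph_L2 G l. \<forall>g\<in>graph_L2 G l.
        (LINT \<omega>|M. W h \<omega> * W g \<omega>) = graph_inner G l h g)"

text \<open>Measurability of \<open>U\<close> into the separable Hilbert space \<open>L\<^sub>2\<close> is weak measurability.\<close>

definition gaussian_L2_variable :: "('v, 'e) pre_digraph \<Rightarrow> ('e \<Rightarrow> real) \<Rightarrow> 'w measure \<Rightarrow>
    ('w \<Rightarrow> ('v, 'e) graph_point \<Rightarrow> real) \<Rightarrow> bool" where
  "gaussian_L2_variable G l M U \<longleftrightarrow>
     (\<forall>\<omega>\<in>space M. U \<omega> \<in> graph_L2 G l) \<and>
     (\<forall>\<psi>\<in>graph_L2 G l. centered_gaussian M (\<lambda>\<omega>. graph_inner G l (U \<omega>) \<psi>))"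

text \<open>
  \<open>U\<close> solves \<open>L\<^sup>\<alpha>\<^sup>/\<^sup>2 (\<tau> U) = W\<close>: \<open>(U, \<psi>) = W (\<tau>\<^sup>-\<^sup>1 L\<^sup>-\<^sup>\<alpha>\<^sup>/\<^sup>2 \<psi>)\<close> almost surely for all \<open>\<psi>\<close>, where \<open>g\<close>
  represents \<open>L\<^sup>-\<^sup>\<alpha>\<^sup>/\<^sup>2 \<psi>\<close>.
\<close>

definition whittle_matern_solution :: "('v, 'e) pre_digraph \<Rightarrow> ('e \<Rightarrow> real) \<Rightarrow>
    real \<Rightarrow> real \<Rightarrow> real \<Rightarrow> (nat \<Rightarrow> real) \<Rightarrow> (nat \<Rightarrow> ('v, 'e) graph_point \<Rightarrow> real) \<Rightarrow> 'w measure \<Rightarrow>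
    ((('v, 'e) graph_point \<Rightarrow> real) \<Rightarrow> 'w \<Rightarrow> real) \<Rightarrow>
    ('w \<Rightarrow> ('v, 'e) graph_point \<Rightarrow> real) \<Rightarrow> bool" where
  "whittle_matern_solution G l \<kappa> \<tau> \<alpha> \<mu> \<phi> M W U \<longleftrightarrow>
     gaussian_L2_variable G l M U \<and>
     (\<forall>\<psi>\<in>graph_L2 G l. \<forall>g. fractional_power G l \<kappa> \<mu> \<phi> (- \<alpha> / 2) \<psi> g \<longrightarrow>
        (AE \<omega> in M. graph_inner G l (U \<omega>) \<psi> = W (\<lambda>x. inverse \<tau> * g x) \<omega>))"

definition continuous_modification :: "('v, 'e) pre_digraph \<Rightarrow> ('e \<Rightarrow> real) \<Rightarrow> 'w measure \<Rightarrow>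
    ('w \<Rightarrow> ('v, 'e) graph_point \<Rightarrow> real) \<Rightarrow> (('v, 'e) graph_point \<Rightarrow> 'w \<Rightarrow> real) \<Rightarrow> bool" where
  "continuous_modification G l M U u \<longleftrightarrow>
     (\<forall>s\<in>graph_points G l. u s \<in> borel_measurable M) \<and>
     (\<forall>\<omega>\<in>space M. continuous_map (graph_topology G l) euclideanreal (\<lambda>s. u s \<omega>)) \<and>
     (AE \<omega> in M. graph_norm G l (\<lambda>s. u s \<omega> - U \<omega> s) = 0)"

end

theory Submission
  imports Defs
begin

text \<open>
  The theorem is Mercer's theorem for the covariance of \<open>u\<close>, read off from the paths. Put
  \<open>a\<^sub>i = \<tau>\<^sup>-\<^sup>1 \<lambda>\<^sub>i\<^bsup>-\<alpha>/2\<^esup>\<close> and let \<open>\<xi>\<^sub>i = (U, \<phi>\<^sub>i) / a\<^sub>i\<close>. Since \<open>L\<^bsup>-\<alpha>/2\<^esup>\<close> multiplies \<open>\<phi>\<^sub>i\<close> by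
  \<open>\<lambda>\<^sub>i\<^bsup>-\<alpha>/2\<^esup>\<close>, the equation gives \<open>(U, \<phi>\<^sub>i) = W (a\<^sub>i \<phi>\<^sub>i)\<close> almost surely, so the isometry of white noise makes
  the \<open>\<xi>\<^sub>i\<close> orthonormal in \<open>L\<^sub>2\<close> of the probability space. They are jointly Gaussian, because a linear
  combination of them is \<open>U\<close> tested against one square integrable function. Uncorrelated jointly
  Gaussian variables are independent (\<open>uncorrelated_gaussian_indep_vars\<close>).

  Parseval's identity, applied to the single path \<open>U \<omega>\<close>, gives
  \<open>(U \<omega>, \<psi>) = (\<Sum>i. a\<^sub>i (\<psi>, \<phi>\<^sub>i) \<xi>\<^sub>i \<omega>)\<close> for every square integrable \<open>\<psi>\<close>. To reach the value at a point \<open>s\<close>, let \<open>\<psi>\<close>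
  run through averaging kernels that concentrate at \<open>s\<close>: then \<open>(U, \<psi>)\<close> tends to \<open>u s\<close> because the
  paths of \<open>u\<close> are continuous, and \<open>(\<psi>, \<phi>\<^sub>i)\<close> tends to \<open>\<phi>\<^sub>i s\<close> because \<open>\<phi>\<^sub>i\<close> is continuous. What makes the
  passage to the limit legitimate is a property of Gaussian variables: almost sure convergence of
  centered Gaussian variables forces convergence of their variances (\<open>centered_gaussian_limit\<close>). Applied
  to differences, it turns almost sure convergence into mean square convergence, and the expansions
  converge coefficientwise to an expansion of the limit (\<open>gaussian_series_limit\<close>). Hence
  \<open>u s = (\<Sum>i. a\<^sub>i \<phi>\<^sub>i s \<xi>\<^sub>i)\<close>; that this series converges almost surely and not only in mean square is
  Kolmogorov's theorem on series of independent variables (\<open>indep_vars_series_converges\<close>).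

  For the uniform statement, orthonormality turns the mean square error of the \<open>n\<close>-th partial sum into
  \<open>\<E> (u s)\<^sup>2 - (\<Sum>i<n. (a\<^sub>i \<phi>\<^sub>i s)\<^sup>2)\<close>. This decreases to \<open>0\<close> in \<open>n\<close> for every \<open>s\<close>. It is continuous in \<open>s\<close>
  along each edge: the \<open>\<phi>\<^sub>i\<close> are continuous, and so is the variance of \<open>u\<close>, again because continuity
  of the paths passes to variances. By Dini's theorem the convergence is uniform on each of the
  finitely many compact edges, and the edges cover the graph.
\<close>

section \<open>Centered Gaussian variables\<close>

lemma square_integrable_product:
  fixes f g :: "'a \<Rightarrow> real"
  assumes [measurable]: "f \<in> borel_measurable M" "g \<in> borel_measurable M"
    and "integrable M (\<lambda>x. (f x)\<^sup>2)" "integrable M (\<lambda>x. (g x)\<^sup>2)"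
  shows "integrable M (\<lambda>x. f x * g x)"
proof (rule Bochner_Integration.integrable_bound)
  show "integrable M (\<lambda>x. (f x)\<^sup>2 + (g x)\<^sup>2)"
    using assms by simp
  show "AE x in M. norm (f x * g x) \<le> norm ((f x)\<^sup>2 + (g x)\<^sup>2)"
  proof (rule AE_I2)
    fix x
    have "2 * \<bar>f x\<bar> * \<bar>g x\<bar> \<le> (f x)\<^sup>2 + (g x)\<^sup>2"
      using sum_squares_bound[of "\<bar>f x\<bar>" "\<bar>g x\<bar>"] by simp
    moreover have "0 \<le> \<bar>f x\<bar> * \<bar>g x\<bar>" by simp
    ultimately show "norm (f x * g x) \<le> norm ((f x)\<^sup>2 + (g x)\<^sup>2)"
      unfolding real_norm_def abs_mult by linarith
  qed
  show "(\<lambda>x. f x * g x) \<in> borel_measurable M" by measurable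
qed

lemma centered_gaussian_measurable [measurable_dest]:
  "centered_gaussian M X \<Longrightarrow> X \<in> borel_measurable M"
  unfolding centered_gaussian_def using distributed_measurable by fastforce

context prob_space
begin

lemma normal_square_integrable:
  assumes "0 < \<sigma>" "distributed M lborel X (normal_density 0 \<sigma>)"
  shows "integrable M (\<lambda>\<omega>. (X \<omega>)\<^sup>2)" and "expectation (\<lambda>\<omega>. (X \<omega>)\<^sup>2) = \<sigma>\<^sup>2"
proof -
  have "integrable lborel (\<lambda>x. normal_density 0 \<sigma> x * x\<^sup>2)"
    using integrable_normal_moment[OF assms(1), of 0 2] by simp
  then show "integrable M (\<lambda>\<omega>. (X \<omega>)\<^sup>2)"
    by (subst distributed_integrable[OF assms(2), of "\<lambda>x. x\<^sup>2", symmetric]) auto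
  have "expectation (\<lambda>\<omega>. (X \<omega>)\<^sup>2) = (LINT x|lborel. normal_density 0 \<sigma> x * x\<^sup>2)"
    by (subst distributed_integral[OF assms(2), of "\<lambda>x. x\<^sup>2", symmetric]) auto
  also have "\<dots> = \<sigma>\<^sup>2"
    using integral_normal_moment_even[OF assms(1), of 0 1] by simp
  finally show "expectation (\<lambda>\<omega>. (X \<omega>)\<^sup>2) = \<sigma>\<^sup>2" .
qed

lemma normal_characteristic_function:
  assumes "0 < \<sigma>" "distributed M lborel X (normal_density 0 \<sigma>)"
  shows "(CLINT \<omega>|M. iexp (t * X \<omega>)) = exp (- (t\<^sup>2 * \<sigma>\<^sup>2) / 2)"
proof -
  have X[measurable]: "X \<in> borel_measurable M"
    using distributed_measurable[OF assms(2)] by simp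
  have "distributed M lborel (\<lambda>\<omega>. (X \<omega> - 0) / \<sigma>) std_normal_density"
    using normal_standard_normal_convert[OF assms(1)] assms(2) by simp
  then have "distr M lborel (\<lambda>\<omega>. X \<omega> / \<sigma>) = std_normal_distribution"
    by (simp add: distributed_def)
  then have "char std_normal_distribution (t * \<sigma>) = (CLINT \<omega>|M. iexp (t * \<sigma> * (X \<omega> / \<sigma>)))"
    unfolding char_def by (subst integral_distr[of _ M lborel, symmetric]) auto
  then show ?thesis
    using assms(1) by (simp add: char_std_normal_distribution power_mult_distrib exp_of_real)
qed

lemma centered_gaussian_square_integrable:
  assumes "centered_gaussian M X"
  shows "integrable M (\<lambda>\<omega>. (X \<omega>)\<^sup>2)"
  using assms unfolding centered_gaussian_def
proof (elim disjE exE conjE)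
  assume "X \<in> borel_measurable M" "AE \<omega> in M. X \<omega> = 0"
  then show ?thesis by (subst integrable_cong_AE[of _ _ "\<lambda>_. 0"]) auto
qed (use normal_square_integrable in blast)

lemma centered_gaussian_expectation:
  assumes "centered_gaussian M X"
  shows "expectation X = 0"
  using assms unfolding centered_gaussian_def
proof (elim disjE exE conjE)
  assume "X \<in> borel_measurable M" "AE \<omega> in M. X \<omega> = 0"
  then show ?thesis by (subst integral_cong_AE[of _ _ "\<lambda>_. 0"]) auto
qed (use normal_distributed_expectation in blast)

lemma centered_gaussian_characteristic_function:
  assumes "centered_gaussian M X"
  shows "(CLINT \<omega>|M. iexp (t * X \<omega>)) = exp (- (t\<^sup>2 * expectation (\<lambda>\<omega>. (X \<omega>)\<^sup>2)) / 2)"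
  using assms unfolding centered_gaussian_def
proof (elim disjE exE conjE)
  assume X: "X \<in> borel_measurable M" "AE \<omega> in M. X \<omega> = 0"
  then have "(CLINT \<omega>|M. iexp (t * X \<omega>)) = (CLINT \<omega>|M. 1)"
    by (intro integral_cong_AE) auto
  moreover have "expectation (\<lambda>\<omega>. (X \<omega>)\<^sup>2) = expectation (\<lambda>\<omega>. 0)"
    using X by (intro integral_cong_AE) auto
  ultimately show ?thesis by (simp add: prob_space)
next
  fix \<sigma> :: real assume "0 < \<sigma>" "distributed M lborel X (normal_density 0 \<sigma>)"
  then show ?thesis
    by (simp only: normal_characteristic_function normal_square_integrable(2))
qed

text \<open>
  The converse of the formula above, by uniqueness of the characteristic function. The variance \<open>0\<close>
  has to be treated apart: the law is then a point mass and has no density.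
\<close>

lemma centered_gaussian_of_characteristic_function:
  assumes X[measurable]: "X \<in> borel_measurable M" and v: "0 \<le> v"
    and char: "\<And>t. (CLINT \<omega>|M. iexp (t * X \<omega>)) = exp (- (t\<^sup>2 * v) / 2)"
  shows "centered_gaussian M X" and "expectation (\<lambda>\<omega>. (X \<omega>)\<^sup>2) = v"
proof -
  have X_char: "char (distr M borel X) t = exp (- (t\<^sup>2 * v) / 2)" for t
    unfolding char_def char[symmetric] by (subst integral_distr) auto
  have "centered_gaussian M X \<and> expectation (\<lambda>\<omega>. (X \<omega>)\<^sup>2) = v"
  proof (cases "v = 0")
    case True
    have "char (distr M borel X) t = char (distr M borel (\<lambda>_. 0)) t" for t
      using X_char[of t] True unfolding char_def
      by (subst (2) integral_distr) (auto simp: prob_space)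
    then have eq: "distr M borel X = distr M borel (\<lambda>_. 0)"
      by (intro Levy_uniqueness real_distribution_distr) auto
    have "AE x in distr M borel X. x = 0"
      unfolding eq by (subst AE_distr_iff) auto
    then have 0: "AE \<omega> in M. X \<omega> = 0" by (subst (asm) AE_distr_iff) auto
    then have "expectation (\<lambda>\<omega>. (X \<omega>)\<^sup>2) = expectation (\<lambda>\<omega>. 0)"
      by (intro integral_cong_AE) auto
    with 0 True show ?thesis by (simp add: centered_gaussian_def)
  next
    case False
    define \<sigma> where "\<sigma> = sqrt v"
    have \<sigma>: "0 < \<sigma>" "\<sigma>\<^sup>2 = v" using v False by (auto simp: \<sigma>_def)
    define N where "N = density lborel (normal_density 0 \<sigma>)"
    interpret N: prob_space N unfolding N_def by (rule prob_space_normal_density[OF \<sigma>(1)])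
    have "distributed N lborel (\<lambda>x. x) (normal_density 0 \<sigma>)"
      by (auto simp: distributed_def N_def intro!: measure_eqI simp: emeasure_distr)
    from N.normal_characteristic_function[OF \<sigma>(1) this]
    have "char N t = exp (- (t\<^sup>2 * v) / 2)" for t
      unfolding char_def by (simp add: \<sigma>)
    moreover have "real_distribution N"
      by unfold_locales (auto simp: N_def)
    ultimately have "distr M borel X = N"
      by (intro Levy_uniqueness real_distribution_distr) (auto simp: X_char)
    moreover have "distr M lborel X = distr M borel X"
      by (rule distr_cong) auto
    ultimately have *: "distributed M lborel X (normal_density 0 \<sigma>)"
      by (simp add: distributed_def N_def)
    show ?thesis
      using normal_square_integrable(2)[OF \<sigma>(1) *] * \<sigma> by (auto simp: centered_gaussian_def)
  qed
  then show "centered_gaussian M X" "expectation (\<lambda>\<omega>. (X \<omega>)\<^sup>2) = v" by auto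
qed

lemma standard_normal_of_centered_gaussian:
  assumes "centered_gaussian M X" "expectation (\<lambda>\<omega>. (X \<omega>)\<^sup>2) = 1"
  shows "distributed M lborel X std_normal_density"
  using assms(1) unfolding centered_gaussian_def
proof (elim disjE exE conjE)
  assume "X \<in> borel_measurable M" "AE \<omega> in M. X \<omega> = 0"
  then have "expectation (\<lambda>\<omega>. (X \<omega>)\<^sup>2) = expectation (\<lambda>\<omega>. 0)"
    by (intro integral_cong_AE) auto
  then show ?thesis using assms(2) by simp
next
  fix \<sigma> :: real assume \<sigma>: "0 < \<sigma>" "distributed M lborel X (normal_density 0 \<sigma>)"
  then have "\<sigma>\<^sup>2 = 1" using normal_square_integrable(2) assms(2) by simp
  then have "\<sigma> = 1" using \<sigma>(1) by (simp add: power2_eq_1_iff)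
  then show ?thesis using \<sigma> by simp
qed

text \<open>
  Dominated convergence gives convergence of the characteristic functions \<open>exp (- t\<^sup>2 v\<^sub>n / 2)\<close> to that of
  the limit, which is continuous with value \<open>1\<close> at \<open>0\<close> and therefore positive at some \<open>t \<noteq> 0\<close>. Taking
  logarithms at this one \<open>t\<close> shows that the variances \<open>v\<^sub>n\<close> converge to a finite number, and the limit
  then has the characteristic function of a Gaussian variable with that variance. With limit \<open>0\<close> this
  says that almost sure convergence implies mean square convergence.
\<close>

lemma centered_gaussian_limit:
  assumes X: "\<And>n. centered_gaussian M (X n)" and Y[measurable]: "Y \<in> borel_measurable M"
    and lim: "AE \<omega> in M. (\<lambda>n. X n \<omega>) \<longlonglongrightarrow> Y \<omega>"
  shows "centered_gaussian M Y"
    and "(\<lambda>n. expectation (\<lambda>\<omega>. (X n \<omega>)\<^sup>2)) \<longlonglongrightarrow> expectation (\<lambda>\<omega>. (Y \<omega>)\<^sup>2)"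
proof -
  note [measurable] = centered_gaussian_measurable[OF X]
  define v where "v n = expectation (\<lambda>\<omega>. (X n \<omega>)\<^sup>2)" for n
  define \<phi> where "\<phi> t = (CLINT \<omega>|M. iexp (t * Y \<omega>))" for t
  have v: "(\<lambda>n. complex_of_real (exp (- (t\<^sup>2 * v n) / 2))) \<longlonglongrightarrow> \<phi> t" for t
  proof -
    have "(\<lambda>n. CLINT \<omega>|M. iexp (t * X n \<omega>)) \<longlonglongrightarrow> (CLINT \<omega>|M. iexp (t * Y \<omega>))"
    proof (rule integral_dominated_convergence[where w="\<lambda>_. 1"])
      show "AE \<omega> in M. (\<lambda>n. iexp (t * X n \<omega>)) \<longlonglongrightarrow> iexp (t * Y \<omega>)"
        using lim by eventually_elim (intro tendsto_intros)
    qed auto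
    then show ?thesis
      by (simp only: centered_gaussian_characteristic_function[OF X] \<phi>_def v_def)
  qed
  have re: "(\<lambda>n. exp (- (t\<^sup>2 * v n) / 2)) \<longlonglongrightarrow> Re (\<phi> t)" for t
    using tendsto_Re[OF v[of t]] by simp
  have \<phi>_real: "\<phi> t = Re (\<phi> t)" for t
    using LIMSEQ_unique[OF v[of t] tendsto_of_real[OF re[of t]]] by simp
  \<comment> \<open>a point away from the origin at which the limit does not vanish\<close>
have "isCont (char (distr M borel Y)) 0" "char (distr M borel Y) 0 = 1"
    by (auto intro: real_distribution.isCont_char real_distribution.char_zero)
  moreover have \<phi>: "char (distr M borel Y) = \<phi>"
    by (auto simp: char_def \<phi>_def integral_distr)
  ultimately have "\<phi> \<midarrow>0\<rightarrow> 1" by (simp add: isCont_def)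
  then have "((\<lambda>t. Re (\<phi> t)) \<longlongrightarrow> 1) (at 0)" using tendsto_Re by fastforce
  then have "eventually (\<lambda>t. Re (\<phi> t) > 0) (at 0)" by (rule order_tendstoD) simp
  then obtain d where "d > 0" "\<And>t. t \<noteq> 0 \<Longrightarrow> dist t 0 < d \<Longrightarrow> Re (\<phi> t) > 0"
    unfolding eventually_at by auto
  then obtain t where t: "t \<noteq> 0" "Re (\<phi> t) > 0"
    using that[of "d / 2"] \<open>d > 0\<close> by simp
  have "(\<lambda>n. ln (exp (- (t\<^sup>2 * v n) / 2))) \<longlonglongrightarrow> ln (Re (\<phi> t))"
    using t by (intro tendsto_ln re) auto
  then have "(\<lambda>n. (- (t\<^sup>2 * v n) / 2) * (- 2 / t\<^sup>2)) \<longlonglongrightarrow> ln (Re (\<phi> t)) * (- 2 / t\<^sup>2)"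
    by (intro tendsto_mult) auto
  then obtain w where vlim: "v \<longlonglongrightarrow> w" using t(1) by auto
  have "\<And>n. 0 \<le> v n" by (simp add: v_def)
  then have w_nonneg: "0 \<le> w" by (intro LIMSEQ_le_const[OF vlim]) auto
  have "(\<lambda>n. exp (- (s\<^sup>2 * v n) / 2)) \<longlonglongrightarrow> exp (- (s\<^sup>2 * w) / 2)" for s
    by (intro tendsto_exp tendsto_divide tendsto_minus tendsto_mult tendsto_const vlim) auto
  then have "Re (\<phi> s) = exp (- (s\<^sup>2 * w) / 2)" for s
    by (rule LIMSEQ_unique[OF re])
  then have char: "\<phi> s = exp (- (s\<^sup>2 * w) / 2)" for s by (subst \<phi>_real) (simp only:)
  have Y_gauss: "centered_gaussian M Y \<and> expectation (\<lambda>\<omega>. (Y \<omega>)\<^sup>2) = w"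
    using centered_gaussian_of_characteristic_function[OF Y w_nonneg] char unfolding \<phi>_def by blast
  then show "centered_gaussian M Y" by blast
  show "(\<lambda>n. expectation (\<lambda>\<omega>. (X n \<omega>)\<^sup>2)) \<longlonglongrightarrow> expectation (\<lambda>\<omega>. (Y \<omega>)\<^sup>2)"
    using vlim Y_gauss by (simp add: v_def[abs_def])
qed

text \<open>
  An almost surely equal variable is the limit of a constant sequence.
\<close>

lemma centered_gaussian_cong_AE:
  assumes "centered_gaussian M X" "Y \<in> borel_measurable M" "AE \<omega> in M. X \<omega> = Y \<omega>"
  shows "centered_gaussian M Y"
proof (rule centered_gaussian_limit(1)[where X="\<lambda>_. X"])
  show "AE \<omega> in M. (\<lambda>_. X \<omega>) \<longlonglongrightarrow> Y \<omega>"
    using assms(3) by eventually_elim simp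
qed (use assms in auto)

section \<open>Independence from characteristic functions\<close>

text \<open>
  If \<open>Z\<close> is uncorrelated with every character of \<open>X\<close>, then \<open>Z\<close> is uncorrelated with every event of
  \<open>X\<close>. After adding a constant, \<open>Z\<close> is positive and can serve as a density: the hypothesis then says
  that \<open>X\<close> has the same characteristic function, hence the same law, under the reweighted measure.
\<close>

lemma expectation_indicator_factorizes:
  fixes X :: "'a \<Rightarrow> real"
  assumes [measurable]: "X \<in> borel_measurable M" "Z \<in> borel_measurable M"
    and bounded: "\<And>\<omega>. \<bar>Z \<omega>\<bar> \<le> C"
    and factor: "\<And>t. (CLINT \<omega>|M. complex_of_real (Z \<omega>) * iexp (t * X \<omega>)) =
      complex_of_real (expectation Z) * (CLINT \<omega>|M. iexp (t * X \<omega>))"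
    and B[measurable]: "B \<in> sets borel"
  shows "expectation (\<lambda>\<omega>. Z \<omega> * indicator B (X \<omega>)) =
    expectation Z * expectation (\<lambda>\<omega>. indicator B (X \<omega>))"
proof -
  \<comment> \<open>the shift makes \<open>Z'\<close> at least \<open>1\<close>, so that its mean can be divided by\<close>
define Z' where "Z' \<omega> = Z \<omega> + (C + 1)" for \<omega>
  have Z'[measurable]: "Z' \<in> borel_measurable M" unfolding Z'_def[abs_def] by measurable
  have pos: "1 \<le> Z' \<omega>" and le: "\<bar>Z' \<omega>\<bar> \<le> 2 * C + 1" for \<omega>
    using bounded[of \<omega>] by (auto simp: Z'_def)
  have Z_int: "integrable M Z"
    using bounded by (intro integrable_const_bound[of _ C]) auto
  define m where "m = expectation Z'"
  have m: "m = expectation Z + (C + 1)"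
    unfolding m_def Z'_def using Z_int by (simp add: prob_space)
  have Z'_int: "integrable M Z'"
    unfolding Z'_def using Z_int by simp
  have "expectation (\<lambda>_. 1) \<le> m"
    unfolding m_def using Z'_int pos by (intro integral_mono) auto
  then have m_pos: "m \<ge> 1" by (simp add: prob_space)
  define P where "P = density M (\<lambda>\<omega>. Z' \<omega> / m)"
  have "emeasure P (space P) = 1"
    unfolding P_def using m_pos pos Z'_int
    by (subst emeasure_density, simp_all, subst nn_integral_eq_integral)
       (auto simp: m_def intro!: divide_nonneg_nonneg order.trans[OF _ pos] cong: nn_integral_cong)
  then interpret P: prob_space P by (rule prob_spaceI)
  have nn: "AE \<omega> in M. 0 \<le> Z' \<omega> / m" using m_pos pos by (auto intro!: divide_nonneg_nonneg order.trans[OF _ pos])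
  have X_P[measurable]: "X \<in> borel_measurable P" by (simp add: P_def)
  have "char (distr P borel X) t = char (distr M borel X) t" for t
  proof -
    have iint: "integrable M (\<lambda>\<omega>. iexp (t * X \<omega>))"
      by (intro integrable_const_bound[of _ 1]) auto
    have "integrable M (\<lambda>\<omega>. complex_of_real (Z \<omega>) * iexp (t * X \<omega>))"
      using bounded by (intro integrable_const_bound[of _ C]) (auto simp: norm_mult)
    then have "(CLINT \<omega>|M. complex_of_real (Z \<omega>) * iexp (t * X \<omega>) + complex_of_real (C + 1) * iexp (t * X \<omega>))
        = complex_of_real (expectation Z) * (CLINT \<omega>|M. iexp (t * X \<omega>)) + complex_of_real (C + 1) * (CLINT \<omega>|M. iexp (t * X \<omega>))"
      using iint factor[of t] by (subst Bochner_Integration.integral_add) (auto simp del: of_real_add of_real_mult)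
    then have *: "(CLINT \<omega>|M. complex_of_real (Z' \<omega>) * iexp (t * X \<omega>)) = complex_of_real m * (CLINT \<omega>|M. iexp (t * X \<omega>))"
      unfolding m Z'_def by (simp add: algebra_simps)
    have "char (distr P borel X) t = (CLINT \<omega>|P. iexp (t * X \<omega>))"
      unfolding char_def by (subst integral_distr) auto
    also have "\<dots> = (CLINT \<omega>|M. (Z' \<omega> / m) *\<^sub>R iexp (t * X \<omega>))"
      unfolding P_def using nn by (subst integral_density) auto
    also have "\<dots> = (CLINT \<omega>|M. complex_of_real (Z' \<omega>) * iexp (t * X \<omega>)) / complex_of_real m"
      by (subst integral_divide_zero[symmetric]) (auto simp: scaleR_conv_of_real)
    also have "\<dots> = (CLINT \<omega>|M. iexp (t * X \<omega>))"
      unfolding * using m_pos by auto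
    also have "\<dots> = char (distr M borel X) t"
      unfolding char_def by (subst integral_distr) auto
    finally show ?thesis .
  qed
  then have "distr P borel X = distr M borel X"
    by (intro Levy_uniqueness real_distribution_distr P.real_distribution_distr) auto
  then have "(LINT x|distr P borel X. indicator B x :: real) = (LINT x|distr M borel X. indicator B x)"
    by simp
  then have "(LINT \<omega>|P. indicator B (X \<omega>) :: real) = expectation (\<lambda>\<omega>. indicator B (X \<omega>))"
    by (subst (asm) (1 2) integral_distr) auto
  also have "(LINT \<omega>|P. indicator B (X \<omega>) :: real) = (LINT \<omega>|M. (Z' \<omega> / m) *\<^sub>R indicator B (X \<omega>))"
    unfolding P_def using nn by (subst integral_density) auto
  also have "\<dots> = expectation (\<lambda>\<omega>. Z' \<omega> * indicator B (X \<omega>)) / m"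
    by (subst integral_divide_zero[symmetric]) auto
  finally have "expectation (\<lambda>\<omega>. Z' \<omega> * indicator B (X \<omega>)) = m * expectation (\<lambda>\<omega>. indicator B (X \<omega>))"
    using m_pos by (simp add: field_simps)
  moreover have "expectation (\<lambda>\<omega>. Z' \<omega> * indicator B (X \<omega>)) =
      expectation (\<lambda>\<omega>. Z \<omega> * indicator B (X \<omega>)) + (C + 1) * expectation (\<lambda>\<omega>. indicator B (X \<omega>))"
  proof -
    have "integrable M (\<lambda>\<omega>. Z \<omega> * indicator B (X \<omega>))"
      using bounded by (intro integrable_const_bound[of _ C]) (auto simp: indicator_def intro: order.trans[OF abs_ge_zero])
    moreover have "integrable M (\<lambda>\<omega>. (C + 1) * indicator B (X \<omega>))"
      by (intro integrable_const_bound[of _ "\<bar>C + 1\<bar>"]) (auto simp: indicator_def)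
    ultimately show ?thesis
      unfolding Z'_def distrib_right[of "Z _"]
      by (subst Bochner_Integration.integral_add) auto
  qed
  ultimately show ?thesis by (simp add: m algebra_simps)
qed

text \<open>
  The hypothesis for \<open>Z\<close> at \<open>- t\<close> is, after conjugation, the hypothesis for the conjugate of \<open>Z\<close> at \<open>t\<close>; so it
  passes to the real part.
\<close>

lemma expectation_indicator_factorizes_Re:
  fixes X :: "'a \<Rightarrow> real" and Z :: "'a \<Rightarrow> complex"
  assumes [measurable]: "X \<in> borel_measurable M" "Z \<in> borel_measurable M"
    and bounded: "\<And>\<omega>. norm (Z \<omega>) \<le> C"
    and factor: "\<And>t. (CLINT \<omega>|M. Z \<omega> * iexp (t * X \<omega>)) =
      (CLINT \<omega>|M. Z \<omega>) * (CLINT \<omega>|M. iexp (t * X \<omega>))"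
    and B[measurable]: "B \<in> sets borel"
  shows "expectation (\<lambda>\<omega>. Re (Z \<omega>) * indicator B (X \<omega>)) =
    expectation (\<lambda>\<omega>. Re (Z \<omega>)) * expectation (\<lambda>\<omega>. indicator B (X \<omega>))"
proof (rule expectation_indicator_factorizes[of _ _ C])
  have int: "integrable M (\<lambda>\<omega>. Z \<omega> * iexp (t * X \<omega>))" for t
    using bounded by (intro integrable_const_bound[of _ C]) (auto simp: norm_mult)
  have Zint: "integrable M Z"
    using bounded by (intro integrable_const_bound[of _ C]) auto
  fix t
  let ?\<phi> = "\<lambda>t. CLINT \<omega>|M. iexp (t * X \<omega>)"
  have cnj_iexp: "cnj (iexp (- t * x)) = iexp (t * x)" for x
    by (simp add: exp_cnj)
  have conj: "cnj (?\<phi> (- t)) = ?\<phi> t"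
    by (subst Bochner_Integration.integral_cnj[symmetric]) (unfold cnj_iexp, rule refl)
  have half: "complex_of_real (Re z) * e = (z * e + cnj z * e) / 2" for z e
    by (simp add: distrib_right[symmetric] complex_add_cnj)
  have "(CLINT \<omega>|M. complex_of_real (Re (Z \<omega>)) * iexp (t * X \<omega>)) =
      (CLINT \<omega>|M. (Z \<omega> * iexp (t * X \<omega>) + cnj (Z \<omega> * iexp (- t * X \<omega>))) / 2)"
    unfolding half complex_cnj_mult cnj_iexp by (rule refl)
  also have "\<dots> = ((CLINT \<omega>|M. Z \<omega> * iexp (t * X \<omega>)) +
      cnj (CLINT \<omega>|M. Z \<omega> * iexp (- t * X \<omega>))) / 2"
    unfolding integral_divide_zero
    by (subst Bochner_Integration.integral_add, intro int, intro int integrable_cnj)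
      (subst Bochner_Integration.integral_cnj, rule refl)
  also have "\<dots> = complex_of_real (Re (CLINT \<omega>|M. Z \<omega>)) * ?\<phi> t"
    unfolding factor complex_cnj_mult conj half by (rule refl)
  also have "Re (CLINT \<omega>|M. Z \<omega>) = expectation (\<lambda>\<omega>. Re (Z \<omega>))"
    using Zint by simp
  finally show "(CLINT \<omega>|M. complex_of_real (Re (Z \<omega>)) * iexp (t * X \<omega>)) =
    complex_of_real (expectation (\<lambda>\<omega>. Re (Z \<omega>))) * ?\<phi> t" .
next
  fix \<omega> show "\<bar>Re (Z \<omega>)\<bar> \<le> C"
    using abs_Re_le_cmod[of "Z \<omega>"] bounded[of \<omega>] by linarith
qed auto

text \<open>
  The imaginary part of \<open>Z\<close> is the real part of \<open>- \<i> * Z\<close>.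
\<close>

lemma expectation_indicator_factorizes_complex:
  fixes X :: "'a \<Rightarrow> real" and Z :: "'a \<Rightarrow> complex"
  assumes [measurable]: "X \<in> borel_measurable M" "Z \<in> borel_measurable M"
    and bounded: "\<And>\<omega>. norm (Z \<omega>) \<le> C"
    and factor: "\<And>t. (CLINT \<omega>|M. Z \<omega> * iexp (t * X \<omega>)) =
      (CLINT \<omega>|M. Z \<omega>) * (CLINT \<omega>|M. iexp (t * X \<omega>))"
    and B[measurable]: "B \<in> sets borel"
  shows "(CLINT \<omega>|M. Z \<omega> * indicator B (X \<omega>)) =
    (CLINT \<omega>|M. Z \<omega>) * (CLINT \<omega>|M. indicator B (X \<omega>))"
proof -
  have int: "integrable M (\<lambda>\<omega>. Z \<omega> * indicator B (X \<omega>))"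
    using bounded by (intro integrable_const_bound[of _ C])
      (auto simp: norm_mult indicator_def intro: order.trans[OF norm_ge_zero])
  have Zint: "integrable M Z" using bounded by (intro integrable_const_bound[of _ C]) auto
  define p :: real where "p = expectation (\<lambda>\<omega>. indicator B (X \<omega>))"
  have p: "(CLINT \<omega>|M. indicator B (X \<omega>)) = complex_of_real p"
    unfolding p_def integral_complex_of_real[symmetric]
    by (intro Bochner_Integration.integral_cong) (auto simp: indicator_def)
  have "Re (CLINT \<omega>|M. Z \<omega> * indicator B (X \<omega>)) = Re (CLINT \<omega>|M. Z \<omega>) * p"
  proof -
    have "Re (CLINT \<omega>|M. Z \<omega> * indicator B (X \<omega>)) = expectation (\<lambda>\<omega>. Re (Z \<omega>) * indicator B (X \<omega>))"
      unfolding integral_Re[OF int, symmetric]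
      by (intro Bochner_Integration.integral_cong) (auto simp: indicator_def)
    also have "\<dots> = expectation (\<lambda>\<omega>. Re (Z \<omega>)) * p"
      unfolding p_def by (rule expectation_indicator_factorizes_Re[OF _ _ bounded factor]) auto
    finally show ?thesis using Zint by simp
  qed
  moreover have "Im (CLINT \<omega>|M. Z \<omega> * indicator B (X \<omega>)) = Im (CLINT \<omega>|M. Z \<omega>) * p"
  proof -
    have "Im (CLINT \<omega>|M. Z \<omega> * indicator B (X \<omega>)) =
        expectation (\<lambda>\<omega>. Re (- \<i> * Z \<omega>) * indicator B (X \<omega>))"
      unfolding integral_Im[OF int, symmetric]
      by (intro Bochner_Integration.integral_cong) (auto simp: indicator_def)
    also have "\<dots> = expectation (\<lambda>\<omega>. Re (- \<i> * Z \<omega>)) * p"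
      unfolding p_def
    proof (rule expectation_indicator_factorizes_Re)
      show "(CLINT \<omega>|M. - \<i> * Z \<omega> * iexp (t * X \<omega>)) =
          (CLINT \<omega>|M. - \<i> * Z \<omega>) * (CLINT \<omega>|M. iexp (t * X \<omega>))" for t
        using factor[of t] by (simp only: mult.assoc integral_mult_right_zero)
    qed (use bounded in \<open>auto simp: norm_mult\<close>)
    finally show ?thesis using Zint by simp
  qed
  ultimately show ?thesis unfolding p by (auto simp: complex_eq_iff)
qed

text \<open>
  Kac's theorem. The characters of the variables are replaced by indicators one at a time: in the
  mixed expectation of some indicators and some characters, the product of all factors but one plays
  the role of \<open>Z\<close> above, so that only the one-dimensional uniqueness theorem is needed.
\<close>

theorem indep_vars_of_characteristic_function:
  fixes X :: "'i \<Rightarrow> 'a \<Rightarrow> real"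
  assumes [measurable]: "\<And>i. i \<in> I \<Longrightarrow> X i \<in> borel_measurable M"
    and factor: "\<And>J c. finite J \<Longrightarrow> J \<subseteq> I \<Longrightarrow>
      (CLINT \<omega>|M. (\<Prod>j\<in>J. iexp (c j * X j \<omega>))) = (\<Prod>j\<in>J. CLINT \<omega>|M. iexp (c j * X j \<omega>))"
  shows "indep_vars (\<lambda>_. borel) X I"
proof -
  have mixed: "(CLINT \<omega>|M. (\<Prod>j\<in>J. indicator (A j) (X j \<omega>)) * (\<Prod>k\<in>K. iexp (c k * X k \<omega>))) =
      (\<Prod>j\<in>J. CLINT \<omega>|M. indicator (A j) (X j \<omega>)) * (\<Prod>k\<in>K. CLINT \<omega>|M. iexp (c k * X k \<omega>))"
    if "finite J" "finite K" "J \<inter> K = {}" "J \<subseteq> I" "K \<subseteq> I" "\<And>j. j \<in> J \<Longrightarrow> A j \<in> sets borel" for J K A c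
    using that
  proof (induction J arbitrary: K c rule: finite_induct)
    case empty
    then show ?case using factor[of K c] by simp
  next
    case (insert j J)
    have [measurable]: "X j \<in> borel_measurable M" "A j \<in> sets borel"
      and [measurable]: "\<And>i. i \<in> J \<Longrightarrow> A i \<in> sets borel" "\<And>i. i \<in> J \<Longrightarrow> X i \<in> borel_measurable M"
      "\<And>i. i \<in> K \<Longrightarrow> X i \<in> borel_measurable M"
      using insert.prems by auto
    define Z where "Z \<omega> = (\<Prod>i\<in>J. indicator (A i) (X i \<omega>)) * (\<Prod>k\<in>K. iexp (c k * X k \<omega>))" for \<omega>
    have Z_eq: "(CLINT \<omega>|M. Z \<omega>) =
        (\<Prod>i\<in>J. CLINT \<omega>|M. indicator (A i) (X i \<omega>)) * (\<Prod>k\<in>K. CLINT \<omega>|M. iexp (c k * X k \<omega>))"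
      unfolding Z_def using insert.prems by (intro insert.IH) auto
    have "(CLINT \<omega>|M. Z \<omega> * indicator (A j) (X j \<omega>)) =
        (CLINT \<omega>|M. Z \<omega>) * (CLINT \<omega>|M. indicator (A j) (X j \<omega>))"
    proof (rule expectation_indicator_factorizes_complex[where C=1])
      show "Z \<in> borel_measurable M" unfolding Z_def[abs_def] by measurable
      show "norm (Z \<omega>) \<le> 1" for \<omega>
        unfolding Z_def norm_mult prod_norm[symmetric]
        by (intro mult_le_one prod_le_1 prod_nonneg conjI) (auto simp: indicator_def)
    next
      fix t
      have j: "j \<notin> K" "finite K" using insert.prems by auto
      have "(CLINT \<omega>|M. Z \<omega> * iexp (t * X j \<omega>)) =
          (CLINT \<omega>|M. (\<Prod>i\<in>J. indicator (A i) (X i \<omega>)) *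
            (\<Prod>k\<in>insert j K. iexp ((c(j := t)) k * X k \<omega>)))"
      proof (intro Bochner_Integration.integral_cong refl)
        fix \<omega>
        have "(\<Prod>k\<in>K. iexp ((c(j := t)) k * X k \<omega>)) = (\<Prod>k\<in>K. iexp (c k * X k \<omega>))"
          using j by (intro prod.cong) auto
        then show "Z \<omega> * iexp (t * X j \<omega>) = (\<Prod>i\<in>J. indicator (A i) (X i \<omega>)) *
            (\<Prod>k\<in>insert j K. iexp ((c(j := t)) k * X k \<omega>))"
          using j by (simp add: Z_def mult_ac)
      qed
      also have "\<dots> = (\<Prod>i\<in>J. CLINT \<omega>|M. indicator (A i) (X i \<omega>)) *
          (\<Prod>k\<in>insert j K. CLINT \<omega>|M. iexp ((c(j := t)) k * X k \<omega>))"
        using insert.prems insert.hyps by (intro insert.IH) auto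
      also have "(\<Prod>k\<in>insert j K. CLINT \<omega>|M. iexp ((c(j := t)) k * X k \<omega>)) =
          (CLINT \<omega>|M. iexp (t * X j \<omega>)) * (\<Prod>k\<in>K. CLINT \<omega>|M. iexp (c k * X k \<omega>))"
      proof -
        have "(\<Prod>k\<in>K. CLINT \<omega>|M. iexp ((c(j := t)) k * X k \<omega>)) = (\<Prod>k\<in>K. CLINT \<omega>|M. iexp (c k * X k \<omega>))"
          using j by (intro prod.cong) auto
        then show ?thesis using j by simp
      qed
      finally show "(CLINT \<omega>|M. Z \<omega> * iexp (t * X j \<omega>)) =
          (CLINT \<omega>|M. Z \<omega>) * (CLINT \<omega>|M. iexp (t * X j \<omega>))"
        unfolding Z_eq by (simp add: mult_ac)
    qed auto
    then show ?case
      unfolding Z_eq using insert.hyps by (simp add: Z_def mult_ac)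
  qed
  have "prob (\<Inter>j\<in>J. X j -` A j \<inter> space M) = (\<Prod>j\<in>J. prob (X j -` A j \<inter> space M))"
    if J: "J \<noteq> {}" "finite J" "J \<subseteq> I" and A[measurable]: "\<And>j. j \<in> J \<Longrightarrow> A j \<in> sets borel" for J A
  proof -
    have [measurable]: "\<And>j. j \<in> J \<Longrightarrow> X j \<in> borel_measurable M" using J by auto
    have ind: "(CLINT \<omega>|M. indicator S \<omega>) = complex_of_real (prob S)" if "S \<in> events" for S
    proof -
      have "(CLINT \<omega>|M. indicator S \<omega>) = (CLINT \<omega>|M. complex_of_real (indicator S \<omega>))"
        by (intro Bochner_Integration.integral_cong) (auto simp: indicator_def)
      then show ?thesis using that by (simp add: Int_absorb2 sets.sets_into_space)
    qed
    have one: "(CLINT \<omega>|M. indicator (A j) (X j \<omega>)) = complex_of_real (prob (X j -` A j \<inter> space M))"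
      if j: "j \<in> J" for j
    proof -
      have "(CLINT \<omega>|M. indicator (A j) (X j \<omega>)) = (CLINT \<omega>|M. indicator (X j -` A j \<inter> space M) \<omega>)"
        by (intro Bochner_Integration.integral_cong) (auto simp: indicator_def)
      then show ?thesis using ind[of "X j -` A j \<inter> space M"] j by simp
    qed
    have sets: "(\<Inter>j\<in>J. X j -` A j \<inter> space M) \<in> events"
      using J by (intro sets.finite_INT) auto
    have "complex_of_real (prob (\<Inter>j\<in>J. X j -` A j \<inter> space M)) =
        (CLINT \<omega>|M. indicator (\<Inter>j\<in>J. X j -` A j \<inter> space M) \<omega>)"
      by (rule ind[OF sets, symmetric])
    also have "\<dots> = (CLINT \<omega>|M. (\<Prod>j\<in>J. indicator (A j) (X j \<omega>)))"
    proof (intro Bochner_Integration.integral_cong refl)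
      fix \<omega> assume "\<omega> \<in> space M"
      then show "indicator (\<Inter>j\<in>J. X j -` A j \<inter> space M) \<omega> = (\<Prod>j\<in>J. indicator (A j) (X j \<omega>) :: complex)"
        using J by (auto simp: indicator_def prod_zero_iff)
    qed
    also have "\<dots> = (\<Prod>j\<in>J. CLINT \<omega>|M. indicator (A j) (X j \<omega>))"
      using mixed[of J "{}" A] J by simp
    also have "\<dots> = complex_of_real (\<Prod>j\<in>J. prob (X j -` A j \<inter> space M))"
      by (simp add: one)
    finally show ?thesis by (simp only: of_real_eq_iff)
  qed
  then show ?thesis
    unfolding indep_vars_def2
  proof (intro conjI ballI indep_setsI)
    fix A J assume *: "J \<noteq> {}" "J \<subseteq> I" "finite J"
      "\<forall>j\<in>J. A j \<in> {X j -` B \<inter> space M |B. B \<in> sets borel}"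
    then have "\<forall>j\<in>J. \<exists>B. A j = X j -` B \<inter> space M \<and> B \<in> sets borel" by auto
    then obtain B where B: "\<And>j. j \<in> J \<Longrightarrow> A j = X j -` B j \<inter> space M" "\<And>j. j \<in> J \<Longrightarrow> B j \<in> sets borel"
      by metis
    assume "\<And>J A. \<lbrakk>J \<noteq> {}; finite J; J \<subseteq> I; \<And>j. j \<in> J \<Longrightarrow> A j \<in> sets borel\<rbrakk>
      \<Longrightarrow> prob (\<Inter>j\<in>J. X j -` A j \<inter> space M) = (\<Prod>j\<in>J. prob (X j -` A j \<inter> space M))"
    from this[of J B] * B show "prob (\<Inter> (A ` J)) = (\<Prod>j\<in>J. prob (A j))" by simp
  qed (auto intro: measurable_sets)
qed

lemma centered_gaussian_product_integrable:
  assumes "centered_gaussian M X" "centered_gaussian M Y"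
  shows "integrable M (\<lambda>\<omega>. X \<omega> * Y \<omega>)"
  using assms
  by (intro square_integrable_product centered_gaussian_measurable centered_gaussian_square_integrable)

lemma expectation_square_sum_orthogonal:
  fixes X :: "'i \<Rightarrow> 'a \<Rightarrow> real"
  assumes "finite J"
    and int: "\<And>i j. i \<in> J \<Longrightarrow> j \<in> J \<Longrightarrow> integrable M (\<lambda>\<omega>. X i \<omega> * X j \<omega>)"
    and orth: "\<And>i j. i \<in> J \<Longrightarrow> j \<in> J \<Longrightarrow> i \<noteq> j \<Longrightarrow> expectation (\<lambda>\<omega>. X i \<omega> * X j \<omega>) = 0"
  shows "expectation (\<lambda>\<omega>. (\<Sum>j\<in>J. c j * X j \<omega>)\<^sup>2) = (\<Sum>j\<in>J. (c j)\<^sup>2 * expectation (\<lambda>\<omega>. (X j \<omega>)\<^sup>2))"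
proof -
  have "expectation (\<lambda>\<omega>. (\<Sum>j\<in>J. c j * X j \<omega>)\<^sup>2) =
      expectation (\<lambda>\<omega>. \<Sum>i\<in>J. \<Sum>j\<in>J. c i * c j * (X i \<omega> * X j \<omega>))"
    by (simp add: power2_eq_square sum_product mult_ac)
  also have "\<dots> = (\<Sum>i\<in>J. \<Sum>j\<in>J. c i * c j * expectation (\<lambda>\<omega>. X i \<omega> * X j \<omega>))"
  proof (subst Bochner_Integration.integral_sum)
    show "(\<Sum>i\<in>J. expectation (\<lambda>\<omega>. \<Sum>j\<in>J. c i * c j * (X i \<omega> * X j \<omega>))) =
        (\<Sum>i\<in>J. \<Sum>j\<in>J. c i * c j * expectation (\<lambda>\<omega>. X i \<omega> * X j \<omega>))"
      using int by (intro sum.cong refl, subst Bochner_Integration.integral_sum) auto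
  qed (use int in \<open>auto intro!: Bochner_Integration.integrable_sum\<close>)
  also have "\<dots> = (\<Sum>i\<in>J. \<Sum>j\<in>J. if j = i then (c i)\<^sup>2 * expectation (\<lambda>\<omega>. (X i \<omega>)\<^sup>2) else 0)"
    by (intro sum.cong) (auto simp: orth power2_eq_square)
  finally show ?thesis using assms(1) by simp
qed

text \<open>
  The characteristic function of a jointly Gaussian family depends only on the variances of the linear
  combinations, and for uncorrelated variables these are sums of variances, so it factorizes.
\<close>

theorem uncorrelated_gaussian_indep_vars:
  fixes X :: "'i \<Rightarrow> 'a \<Rightarrow> real"
  assumes gauss: "\<And>J c. finite J \<Longrightarrow> J \<subseteq> I \<Longrightarrow> centered_gaussian M (\<lambda>\<omega>. \<Sum>j\<in>J. c j * X j \<omega>)"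
    and orth: "\<And>i j. i \<in> I \<Longrightarrow> j \<in> I \<Longrightarrow> i \<noteq> j \<Longrightarrow> expectation (\<lambda>\<omega>. X i \<omega> * X j \<omega>) = 0"
  shows "indep_vars (\<lambda>_. borel) X I"
proof (rule indep_vars_of_characteristic_function)
  have X: "centered_gaussian M (X i)" if "i \<in> I" for i
    using gauss[of "{i}" "\<lambda>_. 1"] that by simp
  then show "\<And>i. i \<in> I \<Longrightarrow> X i \<in> borel_measurable M" by (rule centered_gaussian_measurable)
  fix J and c :: "'i \<Rightarrow> real" assume J: "finite J" "J \<subseteq> I"
  have "(CLINT \<omega>|M. (\<Prod>j\<in>J. iexp (c j * X j \<omega>))) = (CLINT \<omega>|M. iexp (1 * (\<Sum>j\<in>J. c j * X j \<omega>)))"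
    using J(1) by (simp add: exp_sum[symmetric] sum_distrib_left)
  also have "\<dots> = exp (- (1\<^sup>2 * expectation (\<lambda>\<omega>. (\<Sum>j\<in>J. c j * X j \<omega>)\<^sup>2)) / 2)"
    by (rule centered_gaussian_characteristic_function[OF gauss[OF J]])
  also have "expectation (\<lambda>\<omega>. (\<Sum>j\<in>J. c j * X j \<omega>)\<^sup>2) = (\<Sum>j\<in>J. (c j)\<^sup>2 * expectation (\<lambda>\<omega>. (X j \<omega>)\<^sup>2))"
    using J X by (intro expectation_square_sum_orthogonal centered_gaussian_product_integrable orth) auto
  also have "complex_of_real (exp (- (1\<^sup>2 * \<dots>) / 2)) =
      (\<Prod>j\<in>J. complex_of_real (exp (- ((c j)\<^sup>2 * expectation (\<lambda>\<omega>. (X j \<omega>)\<^sup>2)) / 2)))"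
    using J(1) by (simp add: exp_sum[symmetric] sum_negf sum_divide_distrib flip: of_real_prod)
  also have "\<dots> = (\<Prod>j\<in>J. CLINT \<omega>|M. iexp (c j * X j \<omega>))"
    using J X by (intro prod.cong refl centered_gaussian_characteristic_function[symmetric]) auto
  finally show "(CLINT \<omega>|M. (\<Prod>j\<in>J. iexp (c j * X j \<omega>))) = (\<Prod>j\<in>J. CLINT \<omega>|M. iexp (c j * X j \<omega>))" .
qed

section \<open>Convergence of series of independent variables\<close>

lemma indep_vars_product_expectation_zero:
  fixes X :: "nat \<Rightarrow> 'a \<Rightarrow> real"
  assumes indep: "indep_vars (\<lambda>_. borel) X UNIV"
    and sq: "\<And>i. integrable M (\<lambda>\<omega>. (X i \<omega>)\<^sup>2)" and mean: "\<And>i. expectation (X i) = 0"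
    and "i \<noteq> j"
  shows "expectation (\<lambda>\<omega>. X i \<omega> * X j \<omega>) = 0"
proof -
  have [measurable]: "X i \<in> borel_measurable M" for i
    using indep by (auto simp: indep_vars_def)
  have int: "integrable M (X i)" for i
    by (rule square_integrable_imp_integrable[OF _ sq]) simp
  have "expectation (\<lambda>\<omega>. \<Prod>k\<in>{i, j}. X k \<omega>) = (\<Prod>k\<in>{i, j}. expectation (X k))"
    by (rule indep_vars_lebesgue_integral) (auto intro: indep_vars_subset[OF indep] int)
  then show ?thesis using \<open>i \<noteq> j\<close> mean by simp
qed

text \<open>
  Split the event according to the first index \<open>k\<close> at which the partial sum \<open>S\<^sub>k\<close> leaves \<open>(-\<epsilon>, \<epsilon>)\<close>. On
  that part of the space, \<open>S\<^sub>k\<close> is independent of the increment \<open>S\<^sub>n - S\<^sub>k\<close>, which has mean \<open>0\<close>; so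
  continuing to \<open>n\<close> can only increase the second moment, which is at least \<open>\<epsilon>\<^sup>2\<close> times the probability
  of the part already at time \<open>k\<close>.
\<close>

theorem kolmogorov_maximal_inequality:
  fixes X :: "nat \<Rightarrow> 'a \<Rightarrow> real"
  assumes indep: "indep_vars (\<lambda>_. borel) X UNIV"
    and sq: "\<And>i. integrable M (\<lambda>\<omega>. (X i \<omega>)\<^sup>2)" and mean: "\<And>i. expectation (X i) = 0"
    and \<epsilon>: "0 < \<epsilon>"
  shows "prob {\<omega> \<in> space M. \<exists>k\<le>n. \<epsilon> \<le> \<bar>\<Sum>i\<in>{m..<k}. X i \<omega>\<bar>} \<le>
    (\<Sum>i\<in>{m..<n}. expectation (\<lambda>\<omega>. (X i \<omega>)\<^sup>2)) / \<epsilon>\<^sup>2"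
proof -
  have X[measurable]: "X i \<in> borel_measurable M" for i
    using indep by (auto simp: indep_vars_def)
  have int: "integrable M (X i)" for i
    by (rule square_integrable_imp_integrable[OF _ sq]) simp
  have XX_int: "integrable M (\<lambda>\<omega>. X i \<omega> * X j \<omega>)" for i j
    using sq by (intro square_integrable_product) auto
  define S where "S k \<omega> = (\<Sum>i\<in>{m..<k}. X i \<omega>)" for k \<omega>
  have S[measurable]: "S k \<in> borel_measurable M" for k
    unfolding S_def[abs_def] by measurable
  have S_sq: "integrable M (\<lambda>\<omega>. (S k \<omega>)\<^sup>2)" for k
    unfolding S_def power2_eq_square sum_product by (intro Bochner_Integration.integrable_sum XX_int)
  have S_int: "integrable M (S k)" for k
    unfolding S_def[abs_def] by (intro Bochner_Integration.integrable_sum int)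
  define A where "A k = {\<omega> \<in> space M. \<epsilon> \<le> \<bar>S k \<omega>\<bar> \<and> (\<forall>j<k. \<bar>S j \<omega>\<bar> < \<epsilon>)}" for k
  have A[measurable]: "A k \<in> events" for k unfolding A_def by measurable
  have disj: "disjoint_family A"
    unfolding disjoint_family_on_def
  proof (intro ballI impI)
    fix j k :: nat assume "j \<noteq> k"
    then consider "j < k" | "k < j" by linarith
    then show "A j \<inter> A k = {}"
      by cases (force simp: A_def)+
  qed
  have A_union: "{\<omega> \<in> space M. \<exists>k\<le>n. \<epsilon> \<le> \<bar>S k \<omega>\<bar>} = (\<Union>k\<le>n. A k)"
  proof (intro equalityI subsetI)
    fix \<omega> assume *: "\<omega> \<in> {\<omega> \<in> space M. \<exists>k\<le>n. \<epsilon> \<le> \<bar>S k \<omega>\<bar>}"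
    define k where "k = (LEAST k. \<epsilon> \<le> \<bar>S k \<omega>\<bar>)"
    have "\<epsilon> \<le> \<bar>S k \<omega>\<bar>" "k \<le> n"
      using * unfolding k_def by (auto intro: LeastI Least_le[THEN order.trans])
    moreover have "\<bar>S j \<omega>\<bar> < \<epsilon>" if "j < k" for j
      using not_less_Least[of j "\<lambda>k. \<epsilon> \<le> \<bar>S k \<omega>\<bar>"] that by (simp add: k_def not_le)
    ultimately show "\<omega> \<in> (\<Union>k\<le>n. A k)" using * by (auto simp: A_def)
  qed (auto simp: A_def)
  have main: "\<epsilon>\<^sup>2 * prob (A k) \<le> expectation (\<lambda>\<omega>. (S n \<omega>)\<^sup>2 * indicator (A k) \<omega>)" if k: "k \<le> n" for k
  proof -
    let ?S = "\<lambda>j y. \<Sum>i\<in>{m..<j}. y i :: real"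
    let ?P = "PiM {..<k} (\<lambda>_. borel :: real measure)" and ?Q = "PiM {k..<n} (\<lambda>_. borel :: real measure)"
    \<comment> \<open>\<open>S k\<close> on the event and the increment after \<open>k\<close>, as functions of disjoint blocks of the sequence\<close>
define f where "f y = ?S k y * (if \<epsilon> \<le> \<bar>?S k y\<bar> \<and> (\<forall>j<k. \<bar>?S j y\<bar> < \<epsilon>) then 1 else 0)" for y
    define g where "g y = (\<Sum>i\<in>{k..<n} \<inter> {m..}. y i :: real)" for y
    define B where "B = f \<circ> (\<lambda>\<omega>. restrict (\<lambda>i. X i \<omega>) {..<k})"
    define T where "T = g \<circ> (\<lambda>\<omega>. restrict (\<lambda>i. X i \<omega>) {k..<n})"
    have T_eq: "T \<omega> = (\<Sum>i\<in>{k..<n} \<inter> {m..}. X i \<omega>)" for \<omega>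
      unfolding T_def g_def o_def by (intro sum.cong) auto
    have B_eq: "B \<omega> = S k \<omega> * indicator (A k) \<omega>" if "\<omega> \<in> space M" for \<omega>
    proof -
      have "?S j (restrict (\<lambda>i. X i \<omega>) {..<k}) = S j \<omega>" if "j \<le> k" for j
        using that unfolding S_def by (intro sum.cong) auto
      then show ?thesis using that by (simp add: B_def f_def A_def indicator_def)
    qed
    have ST: "S n \<omega> = S k \<omega> + T \<omega>" for \<omega>
    proof -
      have "{m..<n} = {m..<k} \<union> ({k..<n} \<inter> {m..})" using k by auto
      then show ?thesis
        unfolding S_def T_eq by (simp, subst sum.union_disjoint) auto
    qed
    have T_int: "integrable M T" and T_mean: "expectation T = 0"
      unfolding T_eq[abs_def] using mean int by (auto intro!: Bochner_Integration.integrable_sum)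
    have "integrable M (\<lambda>\<omega>. S k \<omega> * indicator (A k) \<omega>)"
      using S_int by (intro integrable_real_mult_indicator) auto
    then have B_int: "integrable M B"
      using B_eq by (simp cong: Bochner_Integration.integrable_cong)
    have BT: "indep_var borel B borel T"
      unfolding B_def T_def
    proof (rule indep_var_compose[OF indep_var_restrict[OF indep]])
      have [measurable]: "?S j \<in> borel_measurable ?P" if "j \<le> k" for j
        using that by (intro borel_measurable_sum measurable_component_singleton) auto
      have [measurable]: "Measurable.pred ?P (\<lambda>y. \<forall>j\<in>{..<k}. \<bar>?S j y\<bar> < \<epsilon>)"
        by (intro pred_intros_finite) auto
      show "f \<in> borel_measurable ?P"
        unfolding f_def[abs_def] by (simp add: Ball_def[symmetric] lessThan_def[symmetric])
      show "g \<in> borel_measurable ?Q"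
        unfolding g_def[abs_def] by (intro borel_measurable_sum measurable_component_singleton) auto
    qed auto
    have SB_int: "integrable M (\<lambda>\<omega>. (S j \<omega>)\<^sup>2 * indicator (A k) \<omega>)" for j
      using S_sq by (intro integrable_real_mult_indicator) auto
    have BT_int: "integrable M (\<lambda>\<omega>. B \<omega> * T \<omega>)" and BT_0: "expectation (\<lambda>\<omega>. B \<omega> * T \<omega>) = 0"
      using indep_var_integrable[OF BT B_int T_int] indep_var_lebesgue_integral[OF BT B_int T_int] T_mean
      by auto
    have "\<epsilon>\<^sup>2 * prob (A k) = expectation (\<lambda>\<omega>. \<epsilon>\<^sup>2 * indicator (A k) \<omega>)"
      by simp
    also have "\<dots> \<le> expectation (\<lambda>\<omega>. (S k \<omega>)\<^sup>2 * indicator (A k) \<omega>)"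
    proof (rule integral_mono)
      fix \<omega>
      show "\<epsilon>\<^sup>2 * indicator (A k) \<omega> \<le> (S k \<omega>)\<^sup>2 * indicator (A k) \<omega>"
        using \<epsilon> power_mono[of \<epsilon> "\<bar>S k \<omega>\<bar>" 2] by (auto simp: A_def indicator_def)
    qed (use SB_int in \<open>auto simp: less_top[symmetric]\<close>)
    also have "\<dots> = expectation (\<lambda>\<omega>. (S k \<omega>)\<^sup>2 * indicator (A k) \<omega> + 2 * (B \<omega> * T \<omega>))"
      using SB_int BT_int BT_0 by simp
    also have "\<dots> \<le> expectation (\<lambda>\<omega>. (S n \<omega>)\<^sup>2 * indicator (A k) \<omega>)"
    proof (rule integral_mono)
      show "(S k \<omega>)\<^sup>2 * indicator (A k) \<omega> + 2 * (B \<omega> * T \<omega>) \<le> (S n \<omega>)\<^sup>2 * indicator (A k) \<omega>"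
        if "\<omega> \<in> space M" for \<omega> using that by (auto simp: ST B_eq indicator_def power2_sum)
    qed (use SB_int BT_int in auto)
    finally show ?thesis .
  qed
  have "\<epsilon>\<^sup>2 * prob (\<Union>k\<le>n. A k) = (\<Sum>k\<le>n. \<epsilon>\<^sup>2 * prob (A k))"
    using disj by (subst finite_measure_finite_Union)
      (auto simp: sum_distrib_left intro: disjoint_family_on_mono)
  also have "\<dots> \<le> (\<Sum>k\<le>n. expectation (\<lambda>\<omega>. (S n \<omega>)\<^sup>2 * indicator (A k) \<omega>))"
    by (intro sum_mono main) auto
  also have "\<dots> = expectation (\<lambda>\<omega>. \<Sum>k\<le>n. (S n \<omega>)\<^sup>2 * indicator (A k) \<omega>)"
    using S_sq by (intro Bochner_Integration.integral_sum[symmetric] integrable_real_mult_indicator) auto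
  also have "\<dots> \<le> expectation (\<lambda>\<omega>. (S n \<omega>)\<^sup>2)"
  proof (rule integral_mono)
    fix \<omega>
    have "(\<Sum>k\<le>n. indicator (A k) \<omega>) = (indicator (\<Union>k\<in>{..n}. A k) \<omega> :: real)"
      using disj by (intro indicator_UN_disjoint[symmetric]) (auto intro: disjoint_family_on_mono)
    also have "\<dots> \<le> 1" by (auto simp: indicator_def)
    finally show "(\<Sum>k\<le>n. (S n \<omega>)\<^sup>2 * indicator (A k) \<omega>) \<le> (S n \<omega>)\<^sup>2"
      unfolding sum_distrib_left[symmetric] by (intro mult_left_le) auto
  qed (intro Bochner_Integration.integrable_sum integrable_real_mult_indicator A S_sq)+
  also have "\<dots> = (\<Sum>i\<in>{m..<n}. expectation (\<lambda>\<omega>. (X i \<omega>)\<^sup>2))"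
    using expectation_square_sum_orthogonal[of "{m..<n}" X "\<lambda>_. 1"] XX_int
      indep_vars_product_expectation_zero[OF indep sq mean] by (simp add: S_def)
  finally show ?thesis
    unfolding A_union[symmetric] S_def using \<epsilon> by (simp add: field_simps)
qed

text \<open>
  The maximal inequality bounds the probability that some partial sum started at \<open>m\<close> exceeds \<open>\<epsilon>\<close> by a
  tail of the convergent series of variances. This tends to \<open>0\<close> in \<open>m\<close>, so almost surely the partial
  sums satisfy the Cauchy criterion for each \<open>\<epsilon> = 1 / (j + 1)\<close>.
\<close>

theorem indep_vars_series_converges:
  fixes X :: "nat \<Rightarrow> 'a \<Rightarrow> real"
  assumes indep: "indep_vars (\<lambda>_. borel) X UNIV"
    and sq: "\<And>i. integrable M (\<lambda>\<omega>. (X i \<omega>)\<^sup>2)" and mean: "\<And>i. expectation (X i) = 0"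
    and summable: "summable (\<lambda>i. expectation (\<lambda>\<omega>. (X i \<omega>)\<^sup>2))"
  shows "AE \<omega> in M. summable (\<lambda>i. X i \<omega>)"
proof -
  have X[measurable]: "X i \<in> borel_measurable M" for i
    using indep by (auto simp: indep_vars_def)
  define v where "v i = expectation (\<lambda>\<omega>. (X i \<omega>)\<^sup>2)" for i
  have v: "0 \<le> v i" "summable v" for i using summable by (auto simp: v_def[abs_def])
  define t where "t m = suminf v - (\<Sum>i<m. v i)" for m
  have t_lim: "t \<longlonglongrightarrow> 0"
    unfolding t_def[abs_def] using tendsto_diff[OF tendsto_const summable_LIMSEQ[OF v(2)], of "suminf v"] by simp
  define bad where "bad \<epsilon> m = {\<omega> \<in> space M. \<exists>k. \<epsilon> \<le> \<bar>\<Sum>i\<in>{m..<k}. X i \<omega>\<bar>}" for \<epsilon> m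
  have bad[measurable]: "bad \<epsilon> m \<in> events" for \<epsilon> m unfolding bad_def by measurable
  have bad_le: "prob (bad \<epsilon> m) \<le> t m / \<epsilon>\<^sup>2" if "0 < \<epsilon>" for \<epsilon> m
  proof -
    let ?E = "\<lambda>n. {\<omega> \<in> space M. \<exists>k\<le>n. \<epsilon> \<le> \<bar>\<Sum>i\<in>{m..<k}. X i \<omega>\<bar>}"
    have "(\<lambda>n. prob (?E n)) \<longlonglongrightarrow> prob (\<Union>n. ?E n)"
      by (intro finite_Lim_measure_incseq) (auto simp: incseq_def intro: order.trans)
    moreover have "(\<Union>n. ?E n) = bad \<epsilon> m" by (auto simp: bad_def)
    moreover have "prob (?E n) \<le> t m / \<epsilon>\<^sup>2" for n
    proof -
      have "prob (?E n) \<le> (\<Sum>i\<in>{m..<n}. v i) / \<epsilon>\<^sup>2"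
        unfolding v_def by (rule kolmogorov_maximal_inequality[OF indep sq mean that])
      also have "(\<Sum>i\<in>{m..<n}. v i) \<le> t m"
      proof (cases "m \<le> n")
        case True
        then have "(\<Sum>i\<in>{m..<n}. v i) = (\<Sum>i<n. v i) - (\<Sum>i<m. v i)"
          by (simp add: lessThan_atLeast0 sum_diff_nat_ivl)
        also have "(\<Sum>i<n. v i) \<le> suminf v" using v by (intro sum_le_suminf) auto
        finally show ?thesis by (simp add: t_def)
      next
        case False
        then show ?thesis using v by (simp add: t_def sum_le_suminf)
      qed
      finally show ?thesis by (simp add: divide_right_mono)
    qed
    ultimately show ?thesis by (intro LIMSEQ_le_const2) auto
  qed
  have "AE \<omega> in M. \<exists>m. \<omega> \<notin> bad \<epsilon> m" if \<epsilon>: "0 < \<epsilon>" for \<epsilon>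
  proof -
    have "prob (\<Inter>m. bad \<epsilon> m) \<le> t m / \<epsilon>\<^sup>2" for m
      by (rule order.trans[OF finite_measure_mono bad_le[OF \<epsilon>]]) auto
    moreover have "(\<lambda>m. t m / \<epsilon>\<^sup>2) \<longlonglongrightarrow> 0"
      using tendsto_divide[OF t_lim tendsto_const, of "\<epsilon>\<^sup>2"] \<epsilon> by simp
    ultimately have "prob (\<Inter>m. bad \<epsilon> m) \<le> 0" by (intro LIMSEQ_le_const) auto
    then have "prob (\<Inter>m. bad \<epsilon> m) = 0" by (simp add: measure_le_0_iff)
    then have "AE \<omega> in M. \<omega> \<notin> (\<Inter>m. bad \<epsilon> m)"
      by (intro AE_not_in) (auto simp: null_sets_def emeasure_eq_measure)
    then show ?thesis by auto
  qed
  then have "AE \<omega> in M. \<forall>j. \<exists>m. \<omega> \<notin> bad (1 / Suc j) m"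
    by (subst AE_all_countable) auto
  then show ?thesis
  proof (rule AE_mp, intro AE_I2 impI)
    fix \<omega> assume \<omega>: "\<omega> \<in> space M" and good: "\<forall>j. \<exists>m. \<omega> \<notin> bad (1 / Suc j) m"
    show "summable (\<lambda>i. X i \<omega>)"
      unfolding summable_Cauchy
    proof (intro allI impI)
      fix e :: real assume "0 < e"
      then obtain j where j: "1 / Suc j < e / 2"
        using nat_approx_posE[of "e / 2"] by auto
      obtain N where N: "\<omega> \<notin> bad (1 / Suc j) N" using good by blast
      have small: "\<bar>\<Sum>i\<in>{N..<k}. X i \<omega>\<bar> < e / 2" for k
        using N \<omega> j unfolding bad_def by (auto simp: not_le dest!: spec[of _ k])
      show "\<exists>N. \<forall>m\<ge>N. \<forall>n. norm (\<Sum>i\<in>{m..<n}. X i \<omega>) < e"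
      proof (intro exI[of _ N] allI impI)
        fix m n assume m: "N \<le> m"
        show "norm (\<Sum>i\<in>{m..<n}. X i \<omega>) < e"
        proof (cases "m \<le> n")
          case True
          then have "(\<Sum>i\<in>{m..<n}. X i \<omega>) = (\<Sum>i\<in>{N..<n}. X i \<omega>) - (\<Sum>i\<in>{N..<m}. X i \<omega>)"
            using m by (simp add: sum_diff_nat_ivl)
          then show ?thesis using small[of n] small[of m] by simp
        qed (use \<open>0 < e\<close> in auto)
      qed
    qed
  qed
qed

end

section \<open>Gaussian series\<close>

text \<open>
  The variables of a jointly Gaussian family that are orthonormal in \<open>L\<^sub>2\<close>; joint Gaussianity is stated
  through linear combinations, which is the form in which white noise provides it.
\<close>

locale orthonormal_gaussian_sequence = prob_space +
  fixes \<xi> :: "nat \<Rightarrow> 'a \<Rightarrow> real"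
  assumes gaussian: "\<And>J c. finite J \<Longrightarrow> centered_gaussian M (\<lambda>\<omega>. \<Sum>i\<in>J. c i * \<xi> i \<omega>)"
    and covariance: "\<And>i j. expectation (\<lambda>\<omega>. \<xi> i \<omega> * \<xi> j \<omega>) = (if i = j then 1 else 0)"
begin

lemma gaussian_single: "centered_gaussian M (\<xi> i)"
  using gaussian[of "{i}" "\<lambda>_. 1"] by simp

lemma measurable_sequence [measurable]: "\<xi> i \<in> borel_measurable M"
  by (rule centered_gaussian_measurable[OF gaussian_single])

lemma standard_normal: "distributed M lborel (\<xi> i) std_normal_density"
  using covariance[of i i]
  by (intro standard_normal_of_centered_gaussian gaussian_single) (simp add: power2_eq_square)

lemma independent: "indep_vars (\<lambda>_. borel) \<xi> UNIV"
  by (intro uncorrelated_gaussian_indep_vars gaussian) (simp_all add: covariance)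

lemma variance_linear_combination:
  assumes "finite J"
  shows "expectation (\<lambda>\<omega>. (\<Sum>i\<in>J. c i * \<xi> i \<omega>)\<^sup>2) = (\<Sum>i\<in>J. (c i)\<^sup>2)"
proof -
  have "expectation (\<lambda>\<omega>. (\<Sum>i\<in>J. c i * \<xi> i \<omega>)\<^sup>2) =
      (\<Sum>i\<in>J. (c i)\<^sup>2 * expectation (\<lambda>\<omega>. (\<xi> i \<omega>)\<^sup>2))"
    by (rule expectation_square_sum_orthogonal[OF assms])
      (auto simp: covariance intro: centered_gaussian_product_integrable gaussian_single)
  then show ?thesis
    using covariance[of i i for i] by (simp add: power2_eq_square)
qed

definition gaussian_series :: "(nat \<Rightarrow> real) \<Rightarrow> ('a \<Rightarrow> real) \<Rightarrow> bool" where
  "gaussian_series c Z \<longleftrightarrow> Z \<in> borel_measurable M \<and> (AE \<omega> in M. (\<lambda>i. c i * \<xi> i \<omega>) sums Z \<omega>)"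

text \<open>
  The partial sums are Gaussian with variances \<open>(\<Sum>i<n. (c i)\<^sup>2)\<close>, and variances follow almost sure limits.
\<close>

lemma gaussian_series_variance:
  assumes "gaussian_series c Z"
  shows "centered_gaussian M Z" and "(\<lambda>i. (c i)\<^sup>2) sums expectation (\<lambda>\<omega>. (Z \<omega>)\<^sup>2)"
proof -
  have lim: "Z \<in> borel_measurable M" "AE \<omega> in M. (\<lambda>n. \<Sum>i<n. c i * \<xi> i \<omega>) \<longlonglongrightarrow> Z \<omega>"
    using assms by (auto simp: gaussian_series_def sums_def)
  have g: "centered_gaussian M (\<lambda>\<omega>. \<Sum>i<n. c i * \<xi> i \<omega>)" for n
    by (rule gaussian) simp
  show "centered_gaussian M Z"
    by (rule centered_gaussian_limit[OF g lim])
  show "(\<lambda>i. (c i)\<^sup>2) sums expectation (\<lambda>\<omega>. (Z \<omega>)\<^sup>2)"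
    using centered_gaussian_limit(2)[OF g lim] by (simp add: variance_linear_combination sums_def)
qed

lemma gaussian_series_diff:
  assumes "gaussian_series c Z" "gaussian_series d Y"
  shows "gaussian_series (\<lambda>i. c i - d i) (\<lambda>\<omega>. Z \<omega> - Y \<omega>)"
proof -
  have [measurable]: "Z \<in> borel_measurable M" "Y \<in> borel_measurable M"
    and AE: "AE \<omega> in M. (\<lambda>i. c i * \<xi> i \<omega>) sums Z \<omega>" "AE \<omega> in M. (\<lambda>i. d i * \<xi> i \<omega>) sums Y \<omega>"
    using assms by (auto simp: gaussian_series_def)
  have "AE \<omega> in M. (\<lambda>i. (c i - d i) * \<xi> i \<omega>) sums (Z \<omega> - Y \<omega>)"
    using AE by eventually_elim (unfold left_diff_distrib, rule sums_diff)
  then show ?thesis by (simp add: gaussian_series_def)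
qed

lemma gaussian_series_finite:
  "gaussian_series (\<lambda>i. if i < n then c i else 0) (\<lambda>\<omega>. \<Sum>i<n. c i * \<xi> i \<omega>)"
proof -
  have "(\<lambda>i. (if i < n then c i else 0) * \<xi> i \<omega>) sums (\<Sum>i<n. c i * \<xi> i \<omega>)" for \<omega>
    using sums_finite[of "{..<n}" "\<lambda>i. (if i < n then c i else 0) * \<xi> i \<omega>"] by simp
  then show ?thesis by (simp add: gaussian_series_def)
qed

lemma gaussian_series_exists:
  assumes "summable (\<lambda>i. (c i)\<^sup>2)"
  shows "gaussian_series c (\<lambda>\<omega>. \<Sum>i. c i * \<xi> i \<omega>)"
proof -
  have "indep_vars (\<lambda>_. borel) (\<lambda>i \<omega>. c i * \<xi> i \<omega>) UNIV"
    by (rule indep_vars_compose2[OF independent]) simp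
  moreover have "centered_gaussian M (\<lambda>\<omega>. c i * \<xi> i \<omega>)" for i
    using gaussian[of "{i}" c] by simp
  moreover have "expectation (\<lambda>\<omega>. (c i * \<xi> i \<omega>)\<^sup>2) = (c i)\<^sup>2" for i
    using variance_linear_combination[of "{i}" c] by simp
  ultimately have "AE \<omega> in M. summable (\<lambda>i. c i * \<xi> i \<omega>)"
    using assms by (intro indep_vars_series_converges)
      (simp_all only: centered_gaussian_square_integrable centered_gaussian_expectation)
  then have "AE \<omega> in M. (\<lambda>i. c i * \<xi> i \<omega>) sums (\<Sum>i. c i * \<xi> i \<omega>)"
    by eventually_elim (rule summable_sums)
  then show ?thesis by (simp add: gaussian_series_def)
qed

lemma gaussian_series_tail:
  assumes "gaussian_series c Z"
  shows "integrable M (\<lambda>\<omega>. (Z \<omega> - (\<Sum>i<n. c i * \<xi> i \<omega>))\<^sup>2)"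
    and "expectation (\<lambda>\<omega>. (Z \<omega> - (\<Sum>i<n. c i * \<xi> i \<omega>))\<^sup>2) =
      expectation (\<lambda>\<omega>. (Z \<omega>)\<^sup>2) - (\<Sum>i<n. (c i)\<^sup>2)"
proof -
  note tail = gaussian_series_variance[OF gaussian_series_diff[OF assms gaussian_series_finite[where c=c and n=n]]]
  show "integrable M (\<lambda>\<omega>. (Z \<omega> - (\<Sum>i<n. c i * \<xi> i \<omega>))\<^sup>2)"
    by (rule centered_gaussian_square_integrable[OF tail(1)])
  have "(\<lambda>i. (c i - (if i < n then c i else 0))\<^sup>2) =
      (\<lambda>i. (c i)\<^sup>2 - (if i < n then (c i)\<^sup>2 else 0))"
    by auto
  moreover have "(\<lambda>i. if i < n then (c i)\<^sup>2 else 0) sums (\<Sum>i<n. (c i)\<^sup>2)"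
    using sums_finite[of "{..<n}" "\<lambda>i. if i < n then (c i)\<^sup>2 else 0"] by simp
  ultimately have "(\<lambda>i. (c i - (if i < n then c i else 0))\<^sup>2) sums
      (expectation (\<lambda>\<omega>. (Z \<omega>)\<^sup>2) - (\<Sum>i<n. (c i)\<^sup>2))"
    using sums_diff[OF gaussian_series_variance(2)[OF assms]] by simp
  then show "expectation (\<lambda>\<omega>. (Z \<omega> - (\<Sum>i<n. c i * \<xi> i \<omega>))\<^sup>2) =
      expectation (\<lambda>\<omega>. (Z \<omega>)\<^sup>2) - (\<Sum>i<n. (c i)\<^sup>2)"
    using tail(2) sums_unique2 by blast
qed

text \<open>
  Limits of expansions can be taken coefficientwise, without a uniform bound on the coefficients.
  The differences \<open>Z\<^sub>k - Z\<^sub>j\<close> are Gaussian, so their almost sure convergence gives \<open>\<E> (Z\<^sub>k - Y)\<^sup>2 \<longlonglongrightarrow> 0\<close>, and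
  Bessel's inequality bounds the \<open>\<ell>\<^sub>2\<close> distance of \<open>b k\<close> from \<open>\<beta>\<close> by this quantity. Hence \<open>\<beta>\<close> is square
  summable, the series with coefficients \<open>\<beta>\<close> converges to some \<open>T\<close>, and \<open>Z\<^sub>k\<close> tends in mean square to \<open>T\<close>
  as well as to \<open>Y\<close>.
\<close>

theorem gaussian_series_limit:
  assumes Z: "\<And>k. gaussian_series (b k) (Z k)" and b: "\<And>i. (\<lambda>k. b k i) \<longlonglongrightarrow> \<beta> i"
    and Y[measurable]: "Y \<in> borel_measurable M" and lim: "AE \<omega> in M. (\<lambda>k. Z k \<omega>) \<longlonglongrightarrow> Y \<omega>"
  shows "gaussian_series \<beta> Y"
proof -
  have [measurable]: "Z k \<in> borel_measurable M" for k using Z by (auto simp: gaussian_series_def)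
  note diff = gaussian_series_variance[OF gaussian_series_diff[OF Z Z]]
  define d where "d k = expectation (\<lambda>\<omega>. (Z k \<omega> - Y \<omega>)\<^sup>2)" for k
  have lim_j: "AE \<omega> in M. (\<lambda>j. Z k \<omega> - Z j \<omega>) \<longlonglongrightarrow> Z k \<omega> - Y \<omega>" for k
    using lim by eventually_elim (intro tendsto_intros)
  note d_lim = centered_gaussian_limit[OF diff(1) _ lim_j]
  have lim_0: "AE \<omega> in M. (\<lambda>k. Z k \<omega> - Y \<omega>) \<longlonglongrightarrow> 0"
    using lim by eventually_elim (simp add: LIM_zero)
  have d: "d \<longlonglongrightarrow> 0"
    using centered_gaussian_limit(2)[OF d_lim(1) _ lim_0] by (simp add: d_def[abs_def])
  have partial_le: "(\<Sum>i<N. f i) \<le> s" if "f sums s" "\<And>i. 0 \<le> f i" for f :: "nat \<Rightarrow> real" and s N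
    using that by (metis sum_le_suminf sums_iff finite_lessThan)
  \<comment> \<open>Bessel's inequality for \<open>Z k - Z j\<close>, in the limit \<open>j \<longlonglongrightarrow> \<infinity>\<close>\<close>
have partial: "(\<Sum>i<N. (b k i - \<beta> i)\<^sup>2) \<le> d k" for k N
  proof (rule LIMSEQ_le)
    show "(\<lambda>j. \<Sum>i<N. (b k i - b j i)\<^sup>2) \<longlonglongrightarrow> (\<Sum>i<N. (b k i - \<beta> i)\<^sup>2)"
      by (intro tendsto_intros b)
    show "(\<lambda>j. expectation (\<lambda>\<omega>. (Z k \<omega> - Z j \<omega>)\<^sup>2)) \<longlonglongrightarrow> d k"
      unfolding d_def by (rule d_lim(2)) simp
    have "(\<Sum>i<N. (b k i - b j i)\<^sup>2) \<le> expectation (\<lambda>\<omega>. (Z k \<omega> - Z j \<omega>)\<^sup>2)" for j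
      by (rule partial_le[OF diff(2)]) simp
    then show "\<exists>n. \<forall>j\<ge>n. (\<Sum>i<N. (b k i - b j i)\<^sup>2) \<le> expectation (\<lambda>\<omega>. (Z k \<omega> - Z j \<omega>)\<^sup>2)"
      by blast
  qed
  have "summable (\<lambda>i. (\<beta> i)\<^sup>2)"
  proof (rule bounded_imp_summable)
    fix n
    have "(\<beta> i)\<^sup>2 \<le> 2 * (b 0 i)\<^sup>2 + 2 * (b 0 i - \<beta> i)\<^sup>2" for i
      using sum_squares_ge_zero[of "2 * b 0 i - \<beta> i" 0] by (simp add: power2_eq_square algebra_simps)
    then have "(\<Sum>i\<le>n. (\<beta> i)\<^sup>2) \<le> (\<Sum>i<Suc n. 2 * (b 0 i)\<^sup>2 + 2 * (b 0 i - \<beta> i)\<^sup>2)"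
      unfolding lessThan_Suc_atMost by (intro sum_mono)
    also have "\<dots> = 2 * (\<Sum>i<Suc n. (b 0 i)\<^sup>2) + 2 * (\<Sum>i<Suc n. (b 0 i - \<beta> i)\<^sup>2)"
      by (simp only: sum.distrib sum_distrib_left)
    also have "\<dots> \<le> 2 * expectation (\<lambda>\<omega>. (Z 0 \<omega>)\<^sup>2) + 2 * d 0"
      by (intro add_mono mult_left_mono partial partial_le[OF gaussian_series_variance(2)[OF Z]]) simp_all
    finally show "(\<Sum>i\<le>n. (\<beta> i)\<^sup>2) \<le> 2 * expectation (\<lambda>\<omega>. (Z 0 \<omega>)\<^sup>2) + 2 * d 0" .
  qed simp
  note T = gaussian_series_exists[OF this]
  define T where "T \<omega> = (\<Sum>i. \<beta> i * \<xi> i \<omega>)" for \<omega>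
  have T_series: "gaussian_series \<beta> T" using T by (simp add: T_def[abs_def])
  then have [measurable]: "T \<in> borel_measurable M" by (simp add: gaussian_series_def)
  note ZT = gaussian_series_variance[OF gaussian_series_diff[OF Z T_series]]
  have "AE \<omega> in M. (\<lambda>k. Z k \<omega> - T \<omega>) \<longlonglongrightarrow> Y \<omega> - T \<omega>"
    using lim by eventually_elim (intro tendsto_intros)
  note YT = centered_gaussian_limit[OF ZT(1) _ this]
  have "expectation (\<lambda>\<omega>. (Y \<omega> - T \<omega>)\<^sup>2) \<le> 0"
  proof (rule LIMSEQ_le[OF YT(2) d])
    have "expectation (\<lambda>\<omega>. (Z k \<omega> - T \<omega>)\<^sup>2) \<le> d k" for k
      using ZT(2)[of k] partial by (intro LIMSEQ_le_const2[of _ _ "d k"]) (auto simp: sums_def)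
    then show "\<exists>n. \<forall>k\<ge>n. expectation (\<lambda>\<omega>. (Z k \<omega> - T \<omega>)\<^sup>2) \<le> d k" by blast
  qed simp
  then have "expectation (\<lambda>\<omega>. (Y \<omega> - T \<omega>)\<^sup>2) = 0" by (intro antisym) auto
  moreover have "integrable M (\<lambda>\<omega>. (Y \<omega> - T \<omega>)\<^sup>2)"
    by (rule centered_gaussian_square_integrable[OF YT(1)]) simp
  ultimately have "AE \<omega> in M. (Y \<omega> - T \<omega>)\<^sup>2 = 0"
    by (subst (asm) integral_nonneg_eq_0_iff_AE) auto
  then have "AE \<omega> in M. Y \<omega> = T \<omega>" by eventually_elim simp
  moreover have "AE \<omega> in M. (\<lambda>i. \<beta> i * \<xi> i \<omega>) sums T \<omega>"
    using T_series by (simp add: gaussian_series_def)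
  ultimately have "AE \<omega> in M. (\<lambda>i. \<beta> i * \<xi> i \<omega>) sums Y \<omega>" by eventually_elim simp
  then show ?thesis by (simp add: gaussian_series_def)
qed

end

section \<open>Parseval identity on the graph\<close>

lemma edge_fun_add: "edge_fun G l (\<lambda>x. f x + g x) e t = edge_fun G l f e t + edge_fun G l g e t"
  and edge_fun_scale: "edge_fun G l (\<lambda>x. c * f x) e t = c * edge_fun G l f e t"
  by (simp_all add: edge_fun_def)

lemma interval_L2_product_integrable:
  assumes "f \<in> interval_L2 a" "g \<in> interval_L2 a"
  shows "integrable (lebesgue_on {0..a}) (\<lambda>t. f t * g t)"
  using assms by (intro square_integrable_product) (auto simp: interval_L2_def)

lemma graph_L2_edge:
  assumes "f \<in> graph_L2 G l" "e \<in> arcs G"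
  shows "edge_fun G l f e \<in> interval_L2 (l e)"
  using assms by (auto simp: graph_L2_def)

lemma graph_L2_zero: "(\<lambda>x. 0) \<in> graph_L2 G l"
  by (simp add: graph_L2_def interval_L2_def edge_fun_def)

lemma graph_L2_scale:
  assumes "f \<in> graph_L2 G l"
  shows "(\<lambda>x. c * f x) \<in> graph_L2 G l"
  using assms by (auto simp: graph_L2_def interval_L2_def edge_fun_def power_mult_distrib)

lemma graph_L2_add:
  assumes "f \<in> graph_L2 G l" "g \<in> graph_L2 G l"
  shows "(\<lambda>x. f x + g x) \<in> graph_L2 G l"
  unfolding graph_L2_def
proof (intro CollectI ballI)
  fix e assume e: "e \<in> arcs G"
  note f = graph_L2_edge[OF assms(1) e] and g = graph_L2_edge[OF assms(2) e]
  have "integrable (lebesgue_on {0..l e}) (\<lambda>t. (edge_fun G l f e t)\<^sup>2 + (edge_fun G l g e t)\<^sup>2 +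
      2 * (edge_fun G l f e t * edge_fun G l g e t))"
    using f g interval_L2_product_integrable[OF f g] by (auto simp: interval_L2_def)
  then show "edge_fun G l (\<lambda>x. f x + g x) e \<in> interval_L2 (l e)"
    using f g unfolding interval_L2_def edge_fun_add[abs_def]
    by (auto simp: power2_sum mult.assoc)
qed

lemma graph_L2_diff:
  assumes "f \<in> graph_L2 G l" "g \<in> graph_L2 G l"
  shows "(\<lambda>x. f x - g x) \<in> graph_L2 G l"
  using graph_L2_add[OF assms(1) graph_L2_scale[OF assms(2), of "-1"]] by simp

lemma graph_L2_sum:
  assumes "finite J" "\<And>i. i \<in> J \<Longrightarrow> f i \<in> graph_L2 G l"
  shows "(\<lambda>x. \<Sum>i\<in>J. c i * f i x) \<in> graph_L2 G l"
  using assms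
proof (induction J rule: finite_induct)
  case (insert j J)
  then show ?case
    using graph_L2_add[OF graph_L2_scale[of "f j" G l "c j"]] by auto
qed (simp add: graph_L2_zero)

lemma graph_inner_commute: "graph_inner G l f g = graph_inner G l g f"
  by (simp add: graph_inner_def mult.commute)

lemma graph_inner_scale_left: "graph_inner G l (\<lambda>x. c * f x) g = c * graph_inner G l f g"
  by (simp add: graph_inner_def edge_fun_scale sum_distrib_left mult.assoc)

lemma graph_inner_scale_right: "graph_inner G l f (\<lambda>x. c * g x) = c * graph_inner G l f g"
  using graph_inner_scale_left by (subst (1 2) graph_inner_commute) 

lemma graph_inner_add_left:
  assumes "f \<in> graph_L2 G l" "g \<in> graph_L2 G l" "h \<in> graph_L2 G l"
  shows "graph_inner G l (\<lambda>x. f x + g x) h = graph_inner G l f h + graph_inner G l g h"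
  unfolding graph_inner_def sum.distrib[symmetric]
proof (intro sum.cong refl)
  fix e assume e: "e \<in> arcs G"
  show "(LINT t|lebesgue_on {0..l e}. edge_fun G l (\<lambda>x. f x + g x) e t * edge_fun G l h e t) =
      (LINT t|lebesgue_on {0..l e}. edge_fun G l f e t * edge_fun G l h e t) +
      (LINT t|lebesgue_on {0..l e}. edge_fun G l g e t * edge_fun G l h e t)"
    unfolding edge_fun_add distrib_right
    by (intro Bochner_Integration.integral_add interval_L2_product_integrable graph_L2_edge assms e)
qed

lemma graph_inner_diff_left:
  assumes "f \<in> graph_L2 G l" "g \<in> graph_L2 G l" "h \<in> graph_L2 G l"
  shows "graph_inner G l (\<lambda>x. f x - g x) h = graph_inner G l f h - graph_inner G l g h"
  using graph_inner_add_left[OF assms(1) graph_L2_scale[OF assms(2), of "-1"] assms(3)]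
    graph_inner_scale_left[of G l "-1" g h] by simp

lemma graph_inner_diff_right:
  assumes "f \<in> graph_L2 G l" "g \<in> graph_L2 G l" "h \<in> graph_L2 G l"
  shows "graph_inner G l h (\<lambda>x. f x - g x) = graph_inner G l h f - graph_inner G l h g"
  using graph_inner_diff_left[OF assms] by (simp add: graph_inner_commute)

lemma graph_inner_sum_left:
  assumes "finite J" "\<And>i. i \<in> J \<Longrightarrow> f i \<in> graph_L2 G l" "g \<in> graph_L2 G l"
  shows "graph_inner G l (\<lambda>x. \<Sum>i\<in>J. c i * f i x) g = (\<Sum>i\<in>J. c i * graph_inner G l (f i) g)"
  using assms
proof (induction J rule: finite_induct)
  case empty
  then show ?case by (simp add: graph_inner_def edge_fun_def)
next
  case (insert j J)
  then show ?case
    by (simp add: graph_inner_add_left graph_L2_scale graph_L2_sum graph_inner_scale_left)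
qed

lemma graph_inner_sum_right:
  assumes "finite J" "\<And>i. i \<in> J \<Longrightarrow> f i \<in> graph_L2 G l" "g \<in> graph_L2 G l"
  shows "graph_inner G l g (\<lambda>x. \<Sum>i\<in>J. c i * f i x) = (\<Sum>i\<in>J. c i * graph_inner G l g (f i))"
  using graph_inner_sum_left[OF assms] by (simp add: graph_inner_commute)

lemma graph_inner_self_nonneg: "0 \<le> graph_inner G l f f"
  unfolding graph_inner_def by (intro sum_nonneg Bochner_Integration.integral_nonneg) simp

lemma graph_norm_squared: "(graph_norm G l f)\<^sup>2 = graph_inner G l f f"
  by (simp add: graph_norm_def graph_inner_self_nonneg)

text \<open>
  The inner product is only semidefinite on functions, so the discriminant argument has a separate
  case for \<open>(f, f) = 0\<close>.
\<close>

lemma graph_Cauchy_Schwarz: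
  assumes f: "f \<in> graph_L2 G l" and g: "g \<in> graph_L2 G l"
  shows "\<bar>graph_inner G l f g\<bar> \<le> graph_norm G l f * graph_norm G l g"
proof -
  let ?ip = "graph_inner G l"
  have quad: "0 \<le> ?ip f f * t\<^sup>2 - 2 * ?ip f g * t + ?ip g g" for t
  proof -
    let ?h = "\<lambda>x. t * f x - g x"
    have tf: "(\<lambda>x. t * f x) \<in> graph_L2 G l" by (rule graph_L2_scale[OF f])
    have h: "?h \<in> graph_L2 G l" by (rule graph_L2_diff[OF tf g])
    have "?ip ?h ?h = t * (t * ?ip f f - ?ip f g) - (t * ?ip g f - ?ip g g)"
      by (simp add: graph_inner_diff_left[OF tf g h] graph_inner_diff_right[OF tf g]
        graph_inner_scale_left graph_inner_scale_right f g)
    then show ?thesis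
      using graph_inner_self_nonneg[of G l ?h]
      by (simp add: graph_inner_commute[of G l g f] power2_eq_square algebra_simps)
  qed
  have "(?ip f g)\<^sup>2 \<le> ?ip f f * ?ip g g"
  proof (cases "?ip f f = 0")
    case True
    have "?ip f g = 0"
    proof (rule ccontr)
      \<comment> \<open>the quadratic is then affine in \<open>t\<close>, and at this \<open>t\<close> it equals \<open>-1\<close>\<close>
assume "?ip f g \<noteq> 0"
      then show False
        using quad[of "(?ip g g + 1) / (2 * ?ip f g)"] True by (simp add: field_simps)
    qed
    then show ?thesis using True by simp
  next
    case False
    then have "0 < ?ip f f" using graph_inner_self_nonneg[of G l f] by simp
    then show ?thesis
      using quad[of "?ip f g / ?ip f f"] by (simp add: field_simps power2_eq_square)
  qed
  then have "sqrt ((?ip f g)\<^sup>2) \<le> sqrt (?ip f f * ?ip g g)" by (rule real_sqrt_le_mono)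
  then show ?thesis by (simp add: graph_norm_def real_sqrt_mult)
qed

lemma graph_inner_eq_of_norm_zero:
  assumes "f \<in> graph_L2 G l" "g \<in> graph_L2 G l" "h \<in> graph_L2 G l"
    and "graph_norm G l (\<lambda>x. f x - g x) = 0"
  shows "graph_inner G l f h = graph_inner G l g h"
  using graph_Cauchy_Schwarz[OF graph_L2_diff[OF assms(1,2)] assms(3)] assms(4)
  by (simp add: graph_inner_diff_left[OF assms(1-3)])

context
  fixes G :: "('v, 'e) pre_digraph" and l :: "'e \<Rightarrow> real" and \<phi> :: "nat \<Rightarrow> ('v, 'e) graph_point \<Rightarrow> real"
  assumes basis: "orthonormal_basis G l \<phi>"
begin

lemma basis_L2: "\<phi> i \<in> graph_L2 G l"
  using basis by (simp add: orthonormal_basis_def)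

lemma basis_orthonormal: "graph_inner G l (\<phi> i) (\<phi> j) = (if i = j then 1 else 0)"
  using basis by (simp add: orthonormal_basis_def)

text \<open>
  Completing the square: among all combinations of the first \<open>n\<close> basis functions, the Fourier
  coefficients give the smallest error. This converts the density of the span, which is how
  completeness of the basis is phrased, into convergence of the Fourier series.
\<close>

lemma basis_approximation_error:
  assumes f: "f \<in> graph_L2 G l"
  shows "(graph_norm G l (\<lambda>x. f x - (\<Sum>i<n. c i * \<phi> i x)))\<^sup>2 =
    graph_inner G l f f - (\<Sum>i<n. (graph_inner G l f (\<phi> i))\<^sup>2) +
    (\<Sum>i<n. (c i - graph_inner G l f (\<phi> i))\<^sup>2)"
proof -
  let ?ip = "graph_inner G l" and ?p = "\<lambda>x. \<Sum>i<n. c i * \<phi> i x"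
  have p: "?p \<in> graph_L2 G l" by (rule graph_L2_sum) (auto simp: basis_L2)
  have "?ip (\<lambda>x. f x - ?p x) (\<lambda>x. f x - ?p x) = ?ip f f - 2 * ?ip f ?p + ?ip ?p ?p"
    by (simp add: graph_inner_diff_left[OF f p graph_L2_diff[OF f p]] graph_inner_diff_right[OF f p]
      f p graph_inner_commute[of G l ?p f])
  also have "?ip f ?p = (\<Sum>i<n. c i * ?ip f (\<phi> i))"
    by (rule graph_inner_sum_right) (auto simp: basis_L2 f)
  also have "?ip ?p ?p = (\<Sum>i<n. c i * ?ip (\<phi> i) ?p)"
    by (rule graph_inner_sum_left) (auto simp: basis_L2 p)
  also have "\<dots> = (\<Sum>i<n. (c i)\<^sup>2)"
  proof (intro sum.cong refl)
    fix i assume "i \<in> {..<n}"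
    have "?ip (\<phi> i) ?p = (\<Sum>j<n. c j * ?ip (\<phi> i) (\<phi> j))"
      by (rule graph_inner_sum_right) (auto simp: basis_L2)
    also have "\<dots> = c i" using \<open>i \<in> {..<n}\<close> by (simp add: basis_orthonormal if_distrib cong: if_cong)
    finally show "c i * ?ip (\<phi> i) ?p = (c i)\<^sup>2" by (simp add: power2_eq_square)
  qed
  finally show ?thesis
    by (simp add: graph_norm_squared power2_diff sum.distrib sum_subtractf sum_distrib_left mult_ac)
qed

lemma Parseval_norm:
  assumes f: "f \<in> graph_L2 G l"
  shows "(\<lambda>i. (graph_inner G l f (\<phi> i))\<^sup>2) sums graph_inner G l f f"
  unfolding sums_def
proof (rule LIMSEQ_I)
  let ?s = "\<lambda>n. \<Sum>i<n. (graph_inner G l f (\<phi> i))\<^sup>2"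
  fix r :: real assume r: "0 < r"
  have upper: "?s n \<le> graph_inner G l f f" for n
    using basis_approximation_error[OF f, where n=n and c="\<lambda>i. graph_inner G l f (\<phi> i)"]
      zero_le_power2[of "graph_norm G l (\<lambda>x. f x - (\<Sum>i<n. graph_inner G l f (\<phi> i) * \<phi> i x))"]
    by simp
  have "0 < sqrt r" using r by simp
  then obtain N c where "graph_norm G l (\<lambda>x. f x - (\<Sum>i<N. c i * \<phi> i x)) < sqrt r"
    using basis f unfolding orthonormal_basis_def by meson
  then have "(graph_norm G l (\<lambda>x. f x - (\<Sum>i<N. c i * \<phi> i x)))\<^sup>2 < (sqrt r)\<^sup>2"
    by (intro power_strict_mono) (auto simp: graph_norm_def graph_inner_self_nonneg)
  moreover have "0 \<le> (\<Sum>i<N. (c i - graph_inner G l f (\<phi> i))\<^sup>2)" by (intro sum_nonneg) simp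
  ultimately have N: "graph_inner G l f f - ?s N < r"
    using r basis_approximation_error[OF f, where n=N and c=c] by simp
  show "\<exists>no. \<forall>n\<ge>no. norm (?s n - graph_inner G l f f) < r"
  proof (intro exI[of _ N] allI impI)
    fix n assume "N \<le> n"
    then have "?s N \<le> ?s n" by (intro sum_mono2) auto
    then show "norm (?s n - graph_inner G l f f) < r" using N upper[of n] by simp
  qed
qed

text \<open>
  Polarization of the identity for norms.
\<close>

theorem Parseval:
  assumes f: "f \<in> graph_L2 G l" and g: "g \<in> graph_L2 G l"
  shows "(\<lambda>i. graph_inner G l f (\<phi> i) * graph_inner G l g (\<phi> i)) sums graph_inner G l f g"
proof -
  let ?ip = "graph_inner G l"
  have add: "(\<lambda>x. f x + g x) \<in> graph_L2 G l" by (rule graph_L2_add[OF f g])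
  have ip_add: "?ip (\<lambda>x. f x + g x) h = ?ip f h + ?ip g h" if "h \<in> graph_L2 G l" for h
    by (rule graph_inner_add_left[OF f g that])
  have "?ip (\<lambda>x. f x + g x) (\<lambda>x. f x + g x) = ?ip f f + ?ip g g + 2 * ?ip f g"
    using ip_add[OF f] ip_add[OF g] graph_inner_commute[of G l f g]
    by (simp add: ip_add[OF add] graph_inner_commute[of G l _ "\<lambda>x. f x + g x"])
  then have "(\<lambda>i. (?ip f (\<phi> i) + ?ip g (\<phi> i))\<^sup>2) sums (?ip f f + ?ip g g + 2 * ?ip f g)"
    using Parseval_norm[OF add] by (simp add: ip_add basis_L2)
  from sums_diff[OF sums_diff[OF this Parseval_norm[OF f]] Parseval_norm[OF g]]
  have "(\<lambda>i. 2 * (?ip f (\<phi> i) * ?ip g (\<phi> i))) sums (2 * ?ip f g)"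
    by (simp add: power2_sum mult.assoc)
  from sums_mult[OF this, of "1 / 2"] show ?thesis by simp
qed

end

section \<open>Point values as limits of averages\<close>

lemma continuous_interval_L2:
  assumes "continuous_on {0..a} f"
  shows "f \<in> interval_L2 a"
proof -
  have meas: "f \<in> borel_measurable (lebesgue_on {0..a})"
    by (rule continuous_imp_measurable_on_sets_lebesgue[OF assms]) simp
  have "bounded ((\<lambda>t. (f t)\<^sup>2) ` {0..a})"
    using assms by (intro compact_imp_bounded compact_continuous_image continuous_intros) auto
  then obtain C where "\<And>t. t \<in> {0..a} \<Longrightarrow> norm ((f t)\<^sup>2) \<le> C"
    unfolding bounded_iff by blast
  moreover have "finite_measure (lebesgue_on {0..a})"
    by (rule finite_measureI) (cases "0 \<le> a"; simp add: emeasure_restrict_space)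
  ultimately have "integrable (lebesgue_on {0..a}) (\<lambda>t. (f t)\<^sup>2)"
    using meas by (intro finite_measure.integrable_const_bound[of _ _ C]) (auto intro!: AE_I2)
  with meas show ?thesis by (simp add: interval_L2_def)
qed

lemma continuous_graph_L2:
  assumes "compact_metric_graph G l" "continuous_map (graph_topology G l) euclideanreal f"
  shows "f \<in> graph_L2 G l"
  using assms by (auto simp: graph_L2_def edge_fun_def continuous_map_graph_topology
    intro: continuous_interval_L2)

text \<open>
  An interval of length \<open>a / (k + 1)\<close> that shrinks to \<open>t\<close>. Its end points divide \<open>[0, t]\<close> and \<open>[t, a]\<close> in the
  same ratio, so it lies inside \<open>(0, a)\<close> for every \<open>t\<close> in \<open>[0, a]\<close>, including both end points.
\<close>

definition window :: "real \<Rightarrow> real \<Rightarrow> nat \<Rightarrow> real set" where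
  "window a t k = {t - t / Suc k <..< t + (a - t) / Suc k}"

lemma window_subset:
  assumes "t \<in> {0..a}"
  shows "window a t k \<subseteq> {0<..<a}"
proof -
  have "x / Suc k \<le> x" if "0 \<le> x" for x :: real
    using that by (simp add: divide_le_eq mult_le_cancel_left1)
  from this[of t] this[of "a - t"] have "t / Suc k \<le> t" "(a - t) / Suc k \<le> a - t"
    using assms by auto
  then show ?thesis by (auto simp: window_def)
qed

lemma window_weight:
  fixes k :: nat
  assumes "0 < a" "t \<in> {0..a}"
  defines "w \<equiv> \<lambda>x. Suc k / a * indicator (window a t k) x"
  shows "w \<in> interval_L2 a" "integrable (lebesgue_on {0..a}) w"
    and "(LINT x|lebesgue_on {0..a}. w x) = 1"
proof -
  let ?N = "lebesgue_on {0..a}"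
  have sub: "window a t k \<subseteq> {0..a}" using window_subset[OF assms(2), of k] by auto
  have sets: "window a t k \<in> sets ?N"
    using sub by (auto simp: sets_restrict_space window_def intro!: image_eqI[of _ _ "window a t k"])
  have em: "emeasure ?N (window a t k) = ennreal (a / Suc k)"
  proof -
    have "emeasure ?N (window a t k) = emeasure lborel (window a t k)"
      using sub by (subst emeasure_restrict_space) (auto simp: window_def)
    also have "\<dots> = ennreal (a / Suc k)"
      using assms unfolding window_def
      by (subst emeasure_lborel_Ioo) (auto simp: diff_divide_distrib intro: add_nonneg_nonneg order.trans[of _ t])
    finally show ?thesis .
  qed
  then have ind: "integrable ?N (indicator (window a t k) :: real \<Rightarrow> real)"
    using sets by (intro integrable_real_indicator) (auto simp: less_top[symmetric])
  then show "integrable ?N w" unfolding w_def by simp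
  have "measure ?N (window a t k) = a / Suc k"
    using em assms(1) by (simp add: measure_def)
  then show "(LINT x|?N. w x) = 1"
    unfolding w_def using assms(1) sub by (simp add: Int_absorb2)
  have "(\<lambda>x. (w x)\<^sup>2) = (\<lambda>x. (Suc k / a)\<^sup>2 * indicator (window a t k) x)"
    by (auto simp: w_def indicator_def power2_eq_square)
  then show "w \<in> interval_L2 a"
    using ind sets unfolding interval_L2_def by (auto simp: w_def)
qed

lemma window_average_tendsto:
  assumes a: "0 < a" and t: "t \<in> {0..a}" and h: "continuous_on {0..a} h"
  shows "(\<lambda>k. LINT x|lebesgue_on {0..a}. h x * (Suc k / a * indicator (window a t k) x)) \<longlonglongrightarrow> h t"
proof (rule LIMSEQ_I)
  fix r :: real assume r: "0 < r"
  let ?N = "lebesgue_on {0..a}"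
  define w where "w k x = Suc k / a * indicator (window a t k) x" for k :: nat and x :: real
  have sub: "window a t k \<subseteq> {0..a}" for k
    using window_subset[OF t, of k] by auto
  have near: "\<bar>x - t\<bar> \<le> a / Suc k" if "x \<in> window a t k" for x k
  proof -
    have "t / Suc k \<le> a / Suc k" "(a - t) / Suc k \<le> a / Suc k"
      using t by (auto intro: divide_right_mono)
    then show ?thesis using that by (auto simp: window_def)
  qed
  note weight = window_weight[OF a t]
  have w_L2: "w k \<in> interval_L2 a" and w_int: "integrable ?N (w k)" and w_1: "(LINT x|?N. w k x) = 1" for k
    using weight[of k] by (simp_all add: w_def[abs_def])
  \<comment> \<open>continuity of \<open>h\<close> at \<open>t\<close>; the weight has integral \<open>1\<close>, so the bound on the window survives averaging\<close>
obtain d where d: "0 < d" "\<And>x. x \<in> {0..a} \<Longrightarrow> \<bar>x - t\<bar> < d \<Longrightarrow> \<bar>h x - h t\<bar> < r / 2"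
    using h t r unfolding continuous_on_iff dist_real_def by (metis half_gt_zero)
  obtain K where K: "a / Suc K < d"
    using nat_approx_posE[of "d / a"] d a by (auto simp: field_simps)
  show "\<exists>no. \<forall>k\<ge>no. norm ((LINT x|?N. h x * (Suc k / a * indicator (window a t k) x)) - h t) < r"
  proof (intro exI[of _ K] allI impI)
    fix k assume k: "K \<le> k"
    have "a / Suc k \<le> a / Suc K" using k a by (intro divide_left_mono) auto
    then have near': "\<bar>h x - h t\<bar> \<le> r / 2" if "x \<in> window a t k" for x
      using d(2)[of x] near[OF that] sub[of k] that K by force
    have hw: "integrable ?N (\<lambda>x. h x * w k x)"
      by (rule interval_L2_product_integrable[OF continuous_interval_L2[OF h] w_L2])
    have "(LINT x|?N. h x * w k x) - h t = (LINT x|?N. (h x - h t) * w k x)"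
      using hw w_int w_1[of k] by (simp add: left_diff_distrib)
    also have "\<bar>\<dots>\<bar> \<le> (LINT x|?N. r / 2 * w k x)"
    proof (rule integral_abs_bound_integral)
      show "integrable ?N (\<lambda>x. (h x - h t) * w k x)"
        using hw w_int by (simp add: left_diff_distrib)
      show "\<bar>(h x - h t) * w k x\<bar> \<le> r / 2 * w k x" for x
        using near'[of x] a unfolding abs_mult
        by (cases "x \<in> window a t k") (auto simp: w_def intro!: mult_right_mono[of _ "r / 2" "(1 + real k) / a", simplified])
    qed (use w_int in simp)
    also have "\<dots> = r / 2" using w_1[of k] by simp
    finally show "norm ((LINT x|?N. h x * (Suc k / a * indicator (window a t k) x)) - h t) < r"
      using r by (simp add: w_def)
  qed
qed
text \<open>
  The function that averages over the window around the point \<open>t\<close> of the edge \<open>e\<close>. It vanishes at the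
  vertices, so it is supported on the one edge even if \<open>t\<close> is an end point of \<open>e\<close>.
\<close>

definition edge_window ::
    "('v, 'e) pre_digraph \<Rightarrow> ('e \<Rightarrow> real) \<Rightarrow> 'e \<Rightarrow> real \<Rightarrow> nat \<Rightarrow> ('v, 'e) graph_point \<Rightarrow> real" where
  "edge_window G l e t k x = (case x of Vertex _ \<Rightarrow> 0
     | Interior e' s \<Rightarrow> if e' = e then real (Suc k) / l e * indicator (window (l e) t k) s else 0)"

lemma edge_fun_edge_window:
  assumes "t \<in> {0..l e}"
  shows "edge_fun G l (edge_window G l e t k) e' s =
    (if e' = e then real (Suc k) / l e * indicator (window (l e) t k) s else 0)"
proof -
  have "s \<notin> window (l e) t k" if "s \<le> 0 \<or> l e \<le> s"
  proof
    assume "s \<in> window (l e) t k"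
    then have "s \<in> {0<..<l e}" by (rule subsetD[OF window_subset[OF assms]])
    then show False using that by auto
  qed
  then show ?thesis by (simp add: edge_fun_def edge_point_def edge_window_def)
qed

lemma edge_window_L2:
  assumes l: "0 < l e" and t: "t \<in> {0..l e}"
  shows "edge_window G l e t k \<in> graph_L2 G l"
proof -
  have "edge_fun G l (edge_window G l e t k) e' \<in> interval_L2 (l e')" for e'
  proof (cases "e' = e")
    case True
    then have "edge_fun G l (edge_window G l e t k) e' =
        (\<lambda>s. real (Suc k) / l e * indicator (window (l e) t k) s)"
      by (intro ext) (simp add: edge_fun_edge_window[where l=l and e=e, OF t])
    then show ?thesis using window_weight(1)[OF l t, of k] True by simp
  next
    case False
    then have "edge_fun G l (edge_window G l e t k) e' = (\<lambda>s. 0)"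
      by (intro ext) (simp add: edge_fun_edge_window[where l=l and e=e, OF t])
    then show ?thesis by (simp add: interval_L2_def)
  qed
  then show ?thesis by (simp add: graph_L2_def)
qed

text \<open>
  Averages of a continuous function over shrinking windows tend to its value. A vertex is reached
  through any one of its edges.
\<close>

theorem edge_window_tendsto:
  assumes G: "compact_metric_graph G l" and e: "e \<in> arcs G" and t: "t \<in> {0..l e}"
    and f: "continuous_map (graph_topology G l) euclideanreal f"
  shows "(\<lambda>k. graph_inner G l f (edge_window G l e t k)) \<longlonglongrightarrow> f (edge_point G l e t)"
proof -
  interpret fin_digraph G using G by (simp add: compact_metric_graph_def)
  have eq: "graph_inner G l f (edge_window G l e t k) =
      (LINT s|lebesgue_on {0..l e}. edge_fun G l f e s * (Suc k / l e * indicator (window (l e) t k) s))" for k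
  proof -
    have "graph_inner G l f (edge_window G l e t k) =
        (\<Sum>e'\<in>arcs G. if e' = e then
          LINT s|lebesgue_on {0..l e}. edge_fun G l f e s * (Suc k / l e * indicator (window (l e) t k) s) else 0)"
      unfolding graph_inner_def edge_fun_edge_window[where G=G and l=l and e=e, OF t]
      by (intro sum.cong refl) simp
    then show ?thesis using e by simp
  qed
  have "continuous_on {0..l e} (edge_fun G l f e)"
    using f e unfolding edge_fun_def continuous_map_graph_topology[OF G] by blast
  moreover have "0 < l e" using G e by (simp add: compact_metric_graph_def)
  ultimately show ?thesis
    unfolding eq using window_average_tendsto[OF _ t, of "edge_fun G l f e"]
    by (simp add: edge_fun_def)
qed

text \<open>
  By connectedness a vertex can be joined to an end point of any given edge, so it is itself an end
  point of some edge.
\<close>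

lemma graph_points_covered:
  assumes G: "compact_metric_graph G l" and arcs: "arcs G \<noteq> {}" and s: "s \<in> graph_points G l"
  obtains e t where "e \<in> arcs G" "t \<in> {0..l e}" "s = edge_point G l e t"
proof -
  interpret fin_digraph G using G by (simp add: compact_metric_graph_def)
  have pos: "0 < l e" if "e \<in> arcs G" for e
    using G that by (simp add: compact_metric_graph_def)
  from s consider v where "v \<in> verts G" "s = Vertex v"
    | e t where "e \<in> arcs G" "0 < t" "t < l e" "s = Interior e t"
    by (auto simp: graph_points_def)
  then show thesis
  proof cases
    case (1 v)
    obtain e0 where e0: "e0 \<in> arcs G" using arcs by blast
    have "\<exists>e\<in>arcs G. tail G e = v \<or> head G e = v"
    proof (cases "tail G e0 = v")
      case False
      have "strongly_connected (mk_symmetric G)"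
        using G by (simp add: compact_metric_graph_def connected_def)
      then have "(v, tail G e0) \<in> rtrancl_on (verts G) (parcs (mk_symmetric G))"
        using 1(1) e0 by (auto simp: strongly_connected_def reachable_def)
      then obtain w where "(v, w) \<in> parcs (mk_symmetric G)"
        using False by (cases rule: converse_rtrancl_on_cases) auto
      then show ?thesis by (auto simp: parcs_mk_symmetric)
    qed (use e0 in auto)
    then obtain e where e: "e \<in> arcs G" "tail G e = v \<or> head G e = v" by blast
    then have "s = edge_point G l e 0 \<or> s = edge_point G l e (l e)"
      using 1(2) pos[of e] by (auto simp: edge_point_def)
    then show thesis using that[of e 0] that[of e "l e"] e(1) pos[of e] by auto
  next
    case (2 e t)
    then show thesis using that[of e t] by (auto simp: edge_point_def)
  qed
qed

section \<open>Uniform convergence of monotone limits\<close>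

text \<open>
  Dini's theorem, by sequential compactness: points where \<open>r n\<close> stays above \<open>\<epsilon>\<close> accumulate at some \<open>y\<close>, and by
  monotonicity and continuity \<open>r m y \<ge> \<epsilon>\<close> for every fixed \<open>m\<close>.
\<close>

theorem Dini_decreasing_to_zero:
  fixes r :: "nat \<Rightarrow> 'x::metric_space \<Rightarrow> real"
  assumes K: "compact K" and cont: "\<And>n. continuous_on K (r n)"
    and anti: "\<And>m n x. x \<in> K \<Longrightarrow> m \<le> n \<Longrightarrow> r n x \<le> r m x"
    and lim: "\<And>x. x \<in> K \<Longrightarrow> (\<lambda>n. r n x) \<longlonglongrightarrow> 0" and \<epsilon>: "0 < \<epsilon>"
  shows "\<exists>N. \<forall>n\<ge>N. \<forall>x\<in>K. r n x < \<epsilon>"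
proof (rule ccontr)
  assume "\<not> ?thesis"
  then have bad: "\<exists>n\<ge>N. \<exists>x\<in>K. \<epsilon> \<le> r n x" for N by (meson not_le)
  have "\<exists>x\<in>K. \<epsilon> \<le> r N x" for N
  proof -
    obtain n x where "N \<le> n" "x \<in> K" "\<epsilon> \<le> r n x" using bad by blast
    then show ?thesis using anti[of x N n] by (intro bexI[of _ x]) auto
  qed
  then obtain x where x: "\<And>N. x N \<in> K" "\<And>N. \<epsilon> \<le> r N (x N)" by metis
  obtain y \<sigma> where y: "y \<in> K" "strict_mono (\<sigma> :: nat \<Rightarrow> nat)" "(x \<circ> \<sigma>) \<longlonglongrightarrow> y"
    using K x(1) unfolding compact_def by blast
  have "\<epsilon> \<le> r m y" for m
  proof (rule LIMSEQ_le_const)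
    show "(\<lambda>n. r m (x (\<sigma> n))) \<longlonglongrightarrow> r m y"
      using continuous_on_tendsto_compose[OF cont[of m] y(3) y(1)] x(1) by simp
    have tail: "\<epsilon> \<le> r m (x (\<sigma> n))" if "m \<le> n" for n
      using x(2)[of "\<sigma> n"] anti[OF x(1), of m "\<sigma> n" "\<sigma> n"] seq_suble[OF y(2), of n] that
      by linarith
    show "\<exists>N. \<forall>n\<ge>N. \<epsilon> \<le> r m (x (\<sigma> n))" using tail by (intro exI[of _ m] allI impI)
  qed
  then have "\<epsilon> \<le> 0" by (intro LIMSEQ_le_const[OF lim[OF y(1)]]) auto
  then show False using \<epsilon> by simp
qed

lemma SUP_tendsto_zero_ennreal:
  assumes "\<And>\<epsilon>. 0 < \<epsilon> \<Longrightarrow> \<exists>N. \<forall>n\<ge>N. \<forall>s\<in>S. f n s \<le> ennreal \<epsilon>"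
  shows "(\<lambda>n. SUP s\<in>S. f n s) \<longlonglongrightarrow> 0"
proof (rule order_tendstoI)
  fix y :: ennreal assume "0 < y"
  then obtain z where z: "0 < z" "z < y" using dense by blast
  then obtain \<epsilon> where \<epsilon>: "z = ennreal \<epsilon>" "0 < \<epsilon>"
    by (cases z) (auto simp: ennreal_less_zero_iff)
  then obtain N where "\<forall>n\<ge>N. \<forall>s\<in>S. f n s \<le> z" using assms by blast
  then have "\<forall>n\<ge>N. (SUP s\<in>S. f n s) < y"
    using z(2) by (meson SUP_least order.strict_trans1)
  then show "eventually (\<lambda>n. (SUP s\<in>S. f n s) < y) sequentially"
    unfolding eventually_sequentially by blast
qed simp

section \<open>The series expansion of the solution\<close>

text \<open>
  The series that defines the power has only one nonzero term.
\<close>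

lemma eigenbasis_fractional_power:
  assumes basis: "orthonormal_basis G l \<phi>"
  shows "fractional_power G l \<kappa> \<mu> \<phi> \<beta> (\<phi> i) (\<lambda>x. (\<kappa>\<^sup>2 + \<mu> i) powr \<beta> * \<phi> i x)"
  unfolding fractional_power_def
proof
  show "(\<lambda>x. (\<kappa>\<^sup>2 + \<mu> i) powr \<beta> * \<phi> i x) \<in> graph_L2 G l"
    by (rule graph_L2_scale[OF basis_L2[OF basis]])
  have "(\<Sum>j<n. (\<kappa>\<^sup>2 + \<mu> j) powr \<beta> * graph_inner G l (\<phi> i) (\<phi> j) * \<phi> j x) =
      (\<kappa>\<^sup>2 + \<mu> i) powr \<beta> * \<phi> i x" if "i < n" for n x
  proof -
    have "(\<Sum>j<n. (\<kappa>\<^sup>2 + \<mu> j) powr \<beta> * graph_inner G l (\<phi> i) (\<phi> j) * \<phi> j x) =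
        (\<Sum>j<n. if j = i then (\<kappa>\<^sup>2 + \<mu> i) powr \<beta> * \<phi> i x else 0)"
      by (intro sum.cong) (auto simp: basis_orthonormal[OF basis])
    then show ?thesis using that by simp
  qed
  then have "graph_norm G l (\<lambda>x. (\<kappa>\<^sup>2 + \<mu> i) powr \<beta> * \<phi> i x -
      (\<Sum>j<n. (\<kappa>\<^sup>2 + \<mu> j) powr \<beta> * graph_inner G l (\<phi> i) (\<phi> j) * \<phi> j x)) = 0" if "i < n" for n
    using that by (simp add: graph_norm_def graph_inner_def edge_fun_def)
  then show "(\<lambda>n. graph_norm G l (\<lambda>x. (\<kappa>\<^sup>2 + \<mu> i) powr \<beta> * \<phi> i x -
      (\<Sum>j<n. (\<kappa>\<^sup>2 + \<mu> j) powr \<beta> * graph_inner G l (\<phi> i) (\<phi> j) * \<phi> j x))) \<longlonglongrightarrow> 0"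
    by (intro tendsto_eventually eventually_sequentiallyI[of "Suc i"]) auto
qed

text \<open>
  Gaussianity comes from \<open>U\<close>, tested against finite combinations of the basis; orthonormality comes from
  the white noise, through \<open>(U, \<phi>\<^sub>i) = W (a\<^sub>i \<phi>\<^sub>i)\<close>.
\<close>

lemma solution_coefficients:
  assumes basis: "orthonormal_basis G l \<phi>" and M: "prob_space M" and noise: "white_noise G l M W"
    and solution: "whittle_matern_solution G l \<kappa> \<tau> \<alpha> \<mu> \<phi> M W U"
    and a_def: "\<And>i. a i = inverse \<tau> * (\<kappa>\<^sup>2 + \<mu> i) powr (- \<alpha> / 2)" and a: "\<And>i. a i \<noteq> 0"
  shows "orthonormal_gaussian_sequence M (\<lambda>i \<omega>. graph_inner G l (U \<omega>) (\<phi> i) / a i)"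
proof -
  interpret prob_space M by (rule M)
  have U_L2: "U \<omega> \<in> graph_L2 G l" if "\<omega> \<in> space M" for \<omega>
    using solution that by (simp add: whittle_matern_solution_def gaussian_L2_variable_def)
  have U_gauss: "centered_gaussian M (\<lambda>\<omega>. graph_inner G l (U \<omega>) \<psi>)" if "\<psi> \<in> graph_L2 G l" for \<psi>
    using solution that by (simp add: whittle_matern_solution_def gaussian_L2_variable_def)
  note [measurable] = centered_gaussian_measurable[OF U_gauss[OF basis_L2[OF basis]]]
  show ?thesis
  proof
    fix J :: "nat set" and c :: "nat \<Rightarrow> real" assume J: "finite J"
    let ?\<psi> = "\<lambda>x. \<Sum>i\<in>J. c i / a i * \<phi> i x"
    have "?\<psi> \<in> graph_L2 G l" by (rule graph_L2_sum[OF J basis_L2[OF basis]])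
    moreover have "graph_inner G l (U \<omega>) ?\<psi> = (\<Sum>i\<in>J. c i * (graph_inner G l (U \<omega>) (\<phi> i) / a i))"
      if "\<omega> \<in> space M" for \<omega>
      by (subst graph_inner_sum_right[OF J basis_L2[OF basis] U_L2[OF that]]) simp
    ultimately show "centered_gaussian M (\<lambda>\<omega>. \<Sum>i\<in>J. c i * (graph_inner G l (U \<omega>) (\<phi> i) / a i))"
      by (intro centered_gaussian_cong_AE[OF U_gauss[of ?\<psi>]] AE_I2) auto
  next
    fix i j
    have L2: "(\<lambda>x. a i * \<phi> i x) \<in> graph_L2 G l" for i
      by (rule graph_L2_scale[OF basis_L2[OF basis]])
    have AE: "AE \<omega> in M. graph_inner G l (U \<omega>) (\<phi> i) = W (\<lambda>x. a i * \<phi> i x) \<omega>" for i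
    proof -
      have "AE \<omega> in M. graph_inner G l (U \<omega>) (\<phi> i) =
          W (\<lambda>x. inverse \<tau> * ((\<kappa>\<^sup>2 + \<mu> i) powr (- \<alpha> / 2) * \<phi> i x)) \<omega>"
        using solution[unfolded whittle_matern_solution_def, THEN conjunct2, rule_format,
          OF basis_L2[OF basis] eigenbasis_fractional_power[OF basis]] .
      then show ?thesis by (simp add: a_def mult.assoc)
    qed
    have W_gauss: "centered_gaussian M (W h)" if "h \<in> graph_L2 G l" for h
    proof -
      have "centered_gaussian M (\<lambda>\<omega>. \<Sum>h\<in>{h}. 1 * W h \<omega>)"
        using noise[unfolded white_noise_def, THEN conjunct1, rule_format, of "{h}" "\<lambda>_. 1"] that by simp
      then show ?thesis by simp
    qed
    note [measurable] = centered_gaussian_measurable[OF W_gauss[OF L2]]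
    have "expectation (\<lambda>\<omega>. graph_inner G l (U \<omega>) (\<phi> i) / a i * (graph_inner G l (U \<omega>) (\<phi> j) / a j)) =
        expectation (\<lambda>\<omega>. W (\<lambda>x. a i * \<phi> i x) \<omega> * W (\<lambda>x. a j * \<phi> j x) \<omega> / (a i * a j))"
    proof (rule integral_cong_AE)
      show "AE \<omega> in M. graph_inner G l (U \<omega>) (\<phi> i) / a i * (graph_inner G l (U \<omega>) (\<phi> j) / a j) =
          W (\<lambda>x. a i * \<phi> i x) \<omega> * W (\<lambda>x. a j * \<phi> j x) \<omega> / (a i * a j)"
        using AE[of i] AE[of j] by eventually_elim simp
    qed measurable
    also have "\<dots> = graph_inner G l (\<lambda>x. a i * \<phi> i x) (\<lambda>x. a j * \<phi> j x) / (a i * a j)"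
      using noise L2[of i] L2[of j] unfolding white_noise_def by simp
    also have "\<dots> = (if i = j then 1 else 0)"
      using a by (simp add: graph_inner_scale_left graph_inner_scale_right basis_orthonormal[OF basis])
    finally show "expectation (\<lambda>\<omega>. graph_inner G l (U \<omega>) (\<phi> i) / a i * (graph_inner G l (U \<omega>) (\<phi> j) / a j)) =
        (if i = j then 1 else 0)" .
  qed
qed

theorem proposition8:
  fixes G :: "('v, 'e) pre_digraph" and l :: "'e \<Rightarrow> real"
    and \<kappa> \<tau> \<alpha> :: real
    and \<mu> :: "nat \<Rightarrow> real" and \<phi> :: "nat \<Rightarrow> ('v, 'e) graph_point \<Rightarrow> real"
    and M :: "'w measure"
    and W :: "(('v, 'e) graph_point \<Rightarrow> real) \<Rightarrow> 'w \<Rightarrow> real"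
    and U :: "'w \<Rightarrow> ('v, 'e) graph_point \<Rightarrow> real"
    and u :: "('v, 'e) graph_point \<Rightarrow> 'w \<Rightarrow> real"
  assumes "compact_metric_graph G l"
    and "\<kappa> > 0" and "\<tau> > 0" and "\<alpha> > 1/2"
    and "kirchhoff_eigenbasis G l \<mu> \<phi>"
    and "prob_space M" and "complete_measure M"
    and "white_noise G l M W"
    and "whittle_matern_solution G l \<kappa> \<tau> \<alpha> \<mu> \<phi> M W U"
    and "continuous_modification G l M U u"
  shows "\<exists>\<xi> :: nat \<Rightarrow> 'w \<Rightarrow> real.
    prob_space.indep_vars M (\<lambda>_. borel) \<xi> UNIV \<and>
    (\<forall>i. distributed M lborel (\<xi> i) std_normal_density) \<and>
    (\<forall>s\<in>graph_points G l. AE \<omega> in M.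
       summable (\<lambda>i. \<xi> i \<omega> * (\<kappa>\<^sup>2 + \<mu> i) powr (- \<alpha> / 2) * \<phi> i s) \<and>
       u s \<omega> = inverse \<tau> * (\<Sum>i. \<xi> i \<omega> * (\<kappa>\<^sup>2 + \<mu> i) powr (- \<alpha> / 2) * \<phi> i s)) \<and>
    (\<lambda>n. SUP s\<in>graph_points G l. \<integral>\<^sup>+ \<omega>. ennreal (\<bar>u s \<omega> -
       inverse \<tau> * (\<Sum>i<n. \<xi> i \<omega> * (\<kappa>\<^sup>2 + \<mu> i) powr (- \<alpha> / 2) * \<phi> i s)\<bar>\<^sup>2) \<partial>M) \<longlonglongrightarrow> 0"
proof -
  note G = assms(1)
  interpret prob_space M by (rule assms(6))
  interpret fin_digraph G using G by (simp add: compact_metric_graph_def)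
  have basis: "orthonormal_basis G l \<phi>" and \<mu>: "0 \<le> \<mu> i"
    and \<phi>_continuous: "continuous_map (graph_topology G l) euclideanreal (\<phi> i)" for i
    using assms(5) by (auto simp: kirchhoff_eigenbasis_def kirchhoff_laplacian_def kirchhoff_domain_def)
  have u_measurable: "\<And>s. s \<in> graph_points G l \<Longrightarrow> u s \<in> borel_measurable M"
    and u_continuous: "\<And>\<omega>. \<omega> \<in> space M \<Longrightarrow>
      continuous_map (graph_topology G l) euclideanreal (\<lambda>s. u s \<omega>)"
    and u_eq_U: "AE \<omega> in M. graph_norm G l (\<lambda>s. u s \<omega> - U \<omega> s) = 0"
    using assms(10) by (auto simp: continuous_modification_def)
  have U_L2: "U \<omega> \<in> graph_L2 G l" if "\<omega> \<in> space M" for \<omega>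
    using assms(9) that by (simp add: whittle_matern_solution_def gaussian_L2_variable_def)
  have U_measurable: "(\<lambda>\<omega>. graph_inner G l (U \<omega>) \<psi>) \<in> borel_measurable M" if "\<psi> \<in> graph_L2 G l" for \<psi>
    using assms(9) that
    by (auto simp: whittle_matern_solution_def gaussian_L2_variable_def intro: centered_gaussian_measurable)
  define a where "a i = inverse \<tau> * (\<kappa>\<^sup>2 + \<mu> i) powr (- \<alpha> / 2)" for i
  have a: "a i \<noteq> 0" for i
  proof -
    have "0 < \<kappa>\<^sup>2 + \<mu> i" using assms(2) \<mu>[of i] by (intro add_pos_nonneg) auto
    then show ?thesis using assms(3) by (simp add: a_def)
  qed
  define \<xi> where "\<xi> i \<omega> = graph_inner G l (U \<omega>) (\<phi> i) / a i" for i \<omega>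
  interpret \<xi>: orthonormal_gaussian_sequence M \<xi>
    unfolding \<xi>_def[abs_def]
    by (rule solution_coefficients[OF basis assms(6,8,9) a_def a])
  \<comment> \<open>Parseval for each single path, hence without exceptional null set\<close>
have test_series: "\<xi>.gaussian_series (\<lambda>i. a i * graph_inner G l \<psi> (\<phi> i)) (\<lambda>\<omega>. graph_inner G l (U \<omega>) \<psi>)"
    if \<psi>: "\<psi> \<in> graph_L2 G l" for \<psi>
    unfolding \<xi>.gaussian_series_def
  proof (intro conjI AE_I2 U_measurable[OF \<psi>])
    fix \<omega> assume "\<omega> \<in> space M"
    from Parseval[OF basis U_L2[OF this] \<psi>]
    show "(\<lambda>i. a i * graph_inner G l \<psi> (\<phi> i) * \<xi> i \<omega>) sums graph_inner G l (U \<omega>) \<psi>"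
      using a by (simp add: \<xi>_def mult.commute)
  qed
  have point: "edge_point G l e t \<in> graph_points G l" if "e \<in> arcs G" for e t
    by (rule edge_point_in_graph_points[OF G that])
  have edge_series: "\<xi>.gaussian_series (\<lambda>i. a i * \<phi> i (edge_point G l e t)) (u (edge_point G l e t))"
    if e: "e \<in> arcs G" and t: "t \<in> {0..l e}" for e t
  proof (rule \<xi>.gaussian_series_limit)
    have l: "0 < l e" using G e by (simp add: compact_metric_graph_def)
    note w = edge_window_L2[where G=G and l=l and e=e, OF l t]
    show "\<xi>.gaussian_series (\<lambda>i. a i * graph_inner G l (edge_window G l e t k) (\<phi> i))
        (\<lambda>\<omega>. graph_inner G l (U \<omega>) (edge_window G l e t k))" for k
      by (rule test_series[OF w])
    show "(\<lambda>k. a i * graph_inner G l (edge_window G l e t k) (\<phi> i)) \<longlonglongrightarrow> a i * \<phi> i (edge_point G l e t)" for i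
      using edge_window_tendsto[OF G e t \<phi>_continuous[of i]]
      by (intro tendsto_mult_left) (simp add: graph_inner_commute)
    show "u (edge_point G l e t) \<in> borel_measurable M" by (rule u_measurable[OF point[OF e]])
    show "AE \<omega> in M. (\<lambda>k. graph_inner G l (U \<omega>) (edge_window G l e t k)) \<longlonglongrightarrow> u (edge_point G l e t) \<omega>"
      using u_eq_U AE_space
    proof eventually_elim
      case (elim \<omega>)
      have "graph_inner G l (U \<omega>) (edge_window G l e t k) =
          graph_inner G l (\<lambda>s. u s \<omega>) (edge_window G l e t k)" for k
        by (rule graph_inner_eq_of_norm_zero[symmetric])
          (use elim in \<open>auto intro: w U_L2 continuous_graph_L2[OF G u_continuous]\<close>)
      then show ?case using edge_window_tendsto[OF G e t u_continuous[OF elim(2)]] by simp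
    qed
  qed
  \<comment> \<open>without edges the space \<open>L\<^sub>2\<close> is trivial and has no unit vector\<close>
have "arcs G \<noteq> {}"
    using basis_orthonormal[OF basis, of 0 0] by (auto simp: graph_inner_def)
  note covered = graph_points_covered[OF G this]
  have u_series: "\<xi>.gaussian_series (\<lambda>i. a i * \<phi> i s) (u s)" if "s \<in> graph_points G l" for s
    using covered[OF that] edge_series by metis
  define V where "V s = expectation (\<lambda>\<omega>. (u s \<omega>)\<^sup>2)" for s
  define r where "r n s = V s - (\<Sum>i<n. (a i * \<phi> i s)\<^sup>2)" for n s
  have partial_sum: "inverse \<tau> * (\<Sum>i<n. \<xi> i \<omega> * (\<kappa>\<^sup>2 + \<mu> i) powr (- \<alpha> / 2) * \<phi> i s) =
      (\<Sum>i<n. a i * \<phi> i s * \<xi> i \<omega>)" for n s \<omega>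
    by (simp add: sum_distrib_left a_def mult_ac)
  have error: "(\<integral>\<^sup>+ \<omega>. ennreal (\<bar>u s \<omega> -
       inverse \<tau> * (\<Sum>i<n. \<xi> i \<omega> * (\<kappa>\<^sup>2 + \<mu> i) powr (- \<alpha> / 2) * \<phi> i s)\<bar>\<^sup>2) \<partial>M) = ennreal (r n s)"
    if "s \<in> graph_points G l" for n s
    unfolding partial_sum power2_abs r_def V_def \<xi>.gaussian_series_tail(2)[OF u_series[OF that], symmetric]
    by (intro nn_integral_eq_integral \<xi>.gaussian_series_tail(1) u_series that) simp
  have r_edge: "\<exists>N. \<forall>n\<ge>N. \<forall>t\<in>{0..l e}. r n (edge_point G l e t) < \<epsilon>" if e: "e \<in> arcs G" and "0 < \<epsilon>" for e \<epsilon>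
  proof (rule Dini_decreasing_to_zero[OF compact_Icc _ _ _ \<open>0 < \<epsilon>\<close>])
    have V_continuous: "continuous_on {0..l e} (\<lambda>t. V (edge_point G l e t))"
      unfolding continuous_on_sequentially
    proof (intro allI ballI impI, elim conjE)
      fix x t assume t: "t \<in> {0..l e}" and x: "\<forall>n. x n \<in> {0..l e}" "x \<longlonglongrightarrow> t"
      have "AE \<omega> in M. (\<lambda>k. u (edge_point G l e (x k)) \<omega>) \<longlonglongrightarrow> u (edge_point G l e t) \<omega>"
      proof (rule AE_I2)
        fix \<omega> assume "\<omega> \<in> space M"
        then have "continuous_on {0..l e} (\<lambda>t. u (edge_point G l e t) \<omega>)"
          using u_continuous e unfolding continuous_map_graph_topology[OF G] by blast
        from continuous_on_tendsto_compose[OF this x(2) t] x(1)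
        show "(\<lambda>k. u (edge_point G l e (x k)) \<omega>) \<longlonglongrightarrow> u (edge_point G l e t) \<omega>" by simp
      qed
      then show "((\<lambda>t. V (edge_point G l e t)) \<circ> x) \<longlonglongrightarrow> V (edge_point G l e t)"
        unfolding o_def V_def
        by (intro centered_gaussian_limit(2) \<xi>.gaussian_series_variance(1)[OF u_series] u_measurable point e)
    qed
    have \<phi>_edge: "continuous_on {0..l e} (\<lambda>t. \<phi> i (edge_point G l e t))" for i
      using \<phi>_continuous[of i] e unfolding continuous_map_graph_topology[OF G] by blast
    show "continuous_on {0..l e} (\<lambda>t. r n (edge_point G l e t))" for n
      unfolding r_def by (intro continuous_intros V_continuous \<phi>_edge)
    show "r n (edge_point G l e t) \<le> r m (edge_point G l e t)" if "m \<le> n" for m n t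
      unfolding r_def using that by (intro diff_left_mono sum_mono2) auto
    show "(\<lambda>n. r n (edge_point G l e t)) \<longlonglongrightarrow> 0" if "t \<in> {0..l e}" for t
      using \<xi>.gaussian_series_variance(2)[OF edge_series[OF e that]] unfolding r_def V_def sums_def
      by (intro tendsto_eq_intros) auto
  qed
  have r_uniform: "\<exists>N. \<forall>n\<ge>N. \<forall>s\<in>graph_points G l. r n s < \<epsilon>" if \<epsilon>: "0 < \<epsilon>" for \<epsilon>
  proof -
    obtain N where N: "\<And>e n t. \<lbrakk>e \<in> arcs G; N e \<le> n; t \<in> {0..l e}\<rbrakk> \<Longrightarrow> r n (edge_point G l e t) < \<epsilon>"
      using r_edge[OF _ \<epsilon>] by metis
    have "r n s < \<epsilon>" if n: "(\<Sum>e\<in>arcs G. N e) \<le> n" and s: "s \<in> graph_points G l" for n s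
    proof -
      obtain e t where *: "e \<in> arcs G" "t \<in> {0..l e}" "s = edge_point G l e t"
        using covered[OF s] by metis
      have "N e \<le> (\<Sum>e\<in>arcs G. N e)" using *(1) by (intro member_le_sum) auto
      then show ?thesis using N[OF *(1) _ *(2)] *(3) n by simp
    qed
    then show ?thesis by blast
  qed
  show ?thesis
  proof (intro exI[of _ \<xi>] conjI allI ballI)
    show "indep_vars (\<lambda>_. borel) \<xi> UNIV" by (rule \<xi>.independent)
    show "distributed M lborel (\<xi> i) std_normal_density" for i by (rule \<xi>.standard_normal)
    show "AE \<omega> in M. summable (\<lambda>i. \<xi> i \<omega> * (\<kappa>\<^sup>2 + \<mu> i) powr (- \<alpha> / 2) * \<phi> i s) \<and>
       u s \<omega> = inverse \<tau> * (\<Sum>i. \<xi> i \<omega> * (\<kappa>\<^sup>2 + \<mu> i) powr (- \<alpha> / 2) * \<phi> i s)"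
      if s: "s \<in> graph_points G l" for s
    proof -
      have "AE \<omega> in M. (\<lambda>i. a i * \<phi> i s * \<xi> i \<omega>) sums u s \<omega>"
        using u_series[OF s] by (simp add: \<xi>.gaussian_series_def)
      then show ?thesis
      proof eventually_elim
        case (elim \<omega>)
        have "(\<lambda>i. \<tau> * (a i * \<phi> i s * \<xi> i \<omega>)) = (\<lambda>i. \<xi> i \<omega> * (\<kappa>\<^sup>2 + \<mu> i) powr (- \<alpha> / 2) * \<phi> i s)"
          using assms(3) by (simp add: a_def fun_eq_iff)
        then have "(\<lambda>i. \<xi> i \<omega> * (\<kappa>\<^sup>2 + \<mu> i) powr (- \<alpha> / 2) * \<phi> i s) sums (\<tau> * u s \<omega>)"
          using sums_mult[OF elim, of \<tau>] by simp
        then show ?case using assms(3) by (simp add: sums_iff)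
      qed
    qed
    show "(\<lambda>n. SUP s\<in>graph_points G l. \<integral>\<^sup>+ \<omega>. ennreal (\<bar>u s \<omega> -
       inverse \<tau> * (\<Sum>i<n. \<xi> i \<omega> * (\<kappa>\<^sup>2 + \<mu> i) powr (- \<alpha> / 2) * \<phi> i s)\<bar>\<^sup>2) \<partial>M) \<longlonglongrightarrow> 0"
    proof (rule SUP_tendsto_zero_ennreal)
      fix \<epsilon> :: real assume "0 < \<epsilon>"
      then obtain N where N: "\<forall>n\<ge>N. \<forall>s\<in>graph_points G l. r n s < \<epsilon>" using r_uniform by blast
      show "\<exists>N. \<forall>n\<ge>N. \<forall>s\<in>graph_points G l. (\<integral>\<^sup>+ \<omega>. ennreal (\<bar>u s \<omega> -
          inverse \<tau> * (\<Sum>i<n. \<xi> i \<omega> * (\<kappa>\<^sup>2 + \<mu> i) powr (- \<alpha> / 2) * \<phi> i s)\<bar>\<^sup>2) \<partial>M) \<le> ennreal \<epsilon>"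
      proof (intro exI[of _ N] allI impI ballI)
        fix n s assume n: "N \<le> n" and s: "s \<in> graph_points G l"
        show "(\<integral>\<^sup>+ \<omega>. ennreal (\<bar>u s \<omega> -
          inverse \<tau> * (\<Sum>i<n. \<xi> i \<omega> * (\<kappa>\<^sup>2 + \<mu> i) powr (- \<alpha> / 2) * \<phi> i s)\<bar>\<^sup>2) \<partial>M) \<le> ennreal \<epsilon>"
          unfolding error[OF s] using N n s by (intro ennreal_leI) (simp add: less_imp_le)
      qed
    qed
  qed
qed

end
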